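(* For the Klein quartic over $\mathbb{F}_8$, with the codes $E(s)$, $\tilde E(\delta)$, $C(s)$, $\tilde C(\delta)$ of length $22$ over $\mathbb{F}_8$ defined in the context, each of the following tuples $(\ell,d_Z,d_X;C_1,C_2)$ satisfies $C_2\subsetneq C_1$, $\dim C_1-\dim C_2=\ell$, $d(C_1,C_2)\ge d_Z$ and $d(C_2^\perp,C_1^\perp)\ge d_X$ (so that the CSS construction applied to $C_2\subsetneq C_1$ yields an asymmetric quantum code with parameters $[[22,\ell,d_Z/d_X]]_8$, where $d_Z,d_X$ are lower bounds on the relative distances): $(1,22,1;E(1),\{\vec 0\})$, $(1,19,2;E(2),E(1))$, $(1,15,4;E(5),E(4))$, $(1,9,8;E(11),E(10))$, $(2,15,3;E(5),E(3))$, $(2,11,5;C(13),(\tilde E(5))^\perp)$, $(3,12,4;E(8),(\tilde C(4))^\perp)$, $(3,10,6;E(10),E(7))$, $(3,8,7;C(10),C(13))$, $(4,13,3;E(7),E(3))$, $(5,10,4;E(10),(\tilde C(4))^\perp)$, $(7,6,6;E(14),E(7))$, $(11,6,3;E(14),E(3))$, $(12,4,4;E(17),(\tilde C(4))^\perp)$, $(14,4,3;E(17),E(3))$, $(15,3,3;\tilde E(3),E(3))$, $(19,2,2;\tilde E(2),E(1))$.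
   Context: Let $\{P_1,\ldots,P_{22}\}\subseteq\mathbb{F}_8^2$ be the set of the 22 affine $\mathbb{F}_8$-rational zeros of the Klein quartic $Y^3+X^3Y+X$. For $F\in\mathbb{F}_8[X,Y]$, $\mathrm{ev}(F)=(F(P_1),\ldots,F(P_{22}))\in\mathbb{F}_8^{22}$. The monomials are, in order, $M_1=1$, $M_2=X$, $M_3=Y$, $M_4=X^2$, $M_5=XY$, $M_6=X^3$, $M_7=Y^2$, $M_8=X^2Y$, $M_9=X^4$, $M_{10}=XY^2$, $M_{11}=X^3Y$, $M_{12}=X^5$, $M_{13}=X^2Y^2$, $M_{14}=X^4Y$, $M_{15}=X^6$, $M_{16}=X^3Y^2$, $M_{17}=X^5Y$, $M_{18}=X^7$, $M_{19}=X^4Y^2$, $M_{20}=X^6Y$, $M_{21}=X^5Y^2$, $M_{22}=X^6Y^2$. Associated integers: $(\sigma_1,\ldots,\sigma_{22})=(22,19,18,16,15,13,13,12,10,10,9,7,7,6,4,5,4,1,3,2,2,1)$, $(\mu_1,\ldots,\mu_{22})=(1,2,2,3,4,4,3,6,6,6,8,8,9,11,12,12,14,15,15,17,18,21)$. Codes: $E(s)=\mathrm{Span}_{\mathbb{F}_8}\{\mathrm{ev}(M_1),\ldots,\mathrm{ev}(M_s)\}$, $\tilde E(\delta)=\mathrm{Span}_{\mathbb{F}_8}\{\mathrm{ev}(M_i)\mid\sigma_i\ge\delta\}$, $C(s)=E(s)^\perp$, $\tilde C(\delta)=\big(\mathrm{Span}_{\mathbb{F}_8}\{\mathrm{ev}(M_i)\mid\mu_i<\delta\}\big)^\perp$,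 where $\perp$ is the dual with respect to the standard bilinear form. For nested linear codes $C''\subsetneq C'$, $d(C',C'')=\min\{w_H(\vec c)\mid\vec c\in C'\setminus C''\}$ with $w_H$ the Hamming weight. The CSS construction: from linear codes $C_2\subsetneq C_1\subseteq\mathbb{F}_q^n$ with $\ell=\dim C_1-\dim C_2$ one obtains an asymmetric quantum code with parameters $[[n,\ell,d_Z/d_X]]_q$, where $d_Z=d(C_1,C_2)$ and $d_X=d(C_2^\perp,C_1^\perp)$. *)

theory Defs
  imports "HOL-Analysis.Analysis" "HOL-Computational_Algebra.Polynomial"
begin

text \<open>
  The polynomial ring \<open>\<bbbF>[X,Y]\<close> is represented as \<open>\<bbbF>[X][Y]\<close>, i.e. by the type
  \<open>'a poly poly\<close> whose outer variable is \<open>Y\<close> and whose inner variable is \<open>X\<close>.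
\<close>

definition monomXY :: "nat \<Rightarrow> nat \<Rightarrow> 'a::comm_semiring_1 poly poly" where
  "monomXY a b = monom (monom 1 a) b"

definition eval2 :: "'a::comm_semiring_1 poly poly \<Rightarrow> 'a \<times> 'a \<Rightarrow> 'a" where
  "eval2 F p = poly (poly F [:snd p:]) (fst p)"

definition klein_quartic :: "'a::comm_semiring_1 poly poly" where
  "klein_quartic = monomXY 0 3 + monomXY 3 1 + monomXY 1 0"

definition klein_points :: "('a::comm_semiring_1 \<times> 'a) set" where
  "klein_points = {p. eval2 klein_quartic p = 0}"


text \<open>
  The vectors of length \<open>n\<close> are the elements of \<open>'a ^ 'n\<close> with \<open>CARD('n) = n\<close>;
  span and dimension over \<open>'a\<close> are \<^const>\<open>vec.span\<close> and \<^const>\<open>vec.dim\<close>.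
\<close>

definition hamming_weight :: "'a::zero ^ 'n::finite \<Rightarrow> nat" where
  "hamming_weight c = card {i. c $ i \<noteq> 0}"

definition dual_code :: "('a::comm_semiring_1 ^ 'n::finite) set \<Rightarrow> ('a ^ 'n) set" where
  "dual_code C = {v. \<forall>c\<in>C. (\<Sum>i\<in>UNIV. v $ i * c $ i) = 0}"

text \<open>Only meaningful for \<open>C'' \<subset> C'\<close> over a finite alphabet, where the set is finite and nonempty.\<close>

definition rel_dist :: "('a::zero ^ 'n::finite) set \<Rightarrow> ('a ^ 'n) set \<Rightarrow> nat" where
  "rel_dist C' C'' = Min (hamming_weight ` (C' - C''))"

text \<open>
  Classical data making the CSS construction on \<open>C2 \<subset> C1\<close> produce an asymmetric quantum code
  of dimension parameter \<open>l\<close> whose two distances are at least \<open>dZ\<close> and \<open>dX\<close>.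
\<close>

definition css_bounds ::
  "nat \<Rightarrow> nat \<Rightarrow> nat \<Rightarrow> ('a::field ^ 'n::finite) set \<Rightarrow> ('a ^ 'n) set \<Rightarrow> bool" where
  "css_bounds l dZ dX C1 C2 \<longleftrightarrow>
     vec.subspace C1 \<and> vec.subspace C2 \<and> C2 \<subset> C1 \<and>
     int (vec.dim C1) - int (vec.dim C2) = int l \<and>
     rel_dist C1 C2 \<ge> dZ \<and>
     rel_dist (dual_code C2) (dual_code C1) \<ge> dX"


text \<open>Exponent pairs \<open>(a, b)\<close> of the monomials \<open>M_i = X^a Y^b\<close>.\<close>

definition M_exponents :: "(nat \<times> nat) list" where
  "M_exponents =
     [(0,0), (1,0), (0,1), (2,0), (1,1), (3,0), (0,2), (2,1), (4,0), (1,2), (3,1),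
      (5,0), (2,2), (4,1), (6,0), (3,2), (5,1), (7,0), (4,2), (6,1), (5,2), (6,2)]"

definition sigma_list :: "nat list" where
  "sigma_list = [22,19,18,16,15,13,13,12,10,10,9,7,7,6,4,5,4,1,3,2,2,1]"

definition mu_list :: "nat list" where
  "mu_list = [1,2,2,3,4,4,3,6,6,6,8,8,9,11,12,12,14,15,15,17,18,21]"

text \<open>The indices \<open>i\<close> below range over \<open>{1..22}\<close>, whereas list positions start at \<open>0\<close>.\<close>

definition M :: "nat \<Rightarrow> 'a::comm_semiring_1 poly poly" where
  "M i = (case M_exponents ! (i - 1) of (a, b) \<Rightarrow> monomXY a b)"

definition sigma :: "nat \<Rightarrow> nat" where
  "sigma i = sigma_list ! (i - 1)"

definition mu :: "nat \<Rightarrow> nat" where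
  "mu i = mu_list ! (i - 1)"


text \<open>In the following, \<open>P\<close> enumerates the evaluation points.\<close>

definition ev :: "('n::finite \<Rightarrow> 'a \<times> 'a) \<Rightarrow> 'a::field poly poly \<Rightarrow> 'a ^ 'n" where
  "ev P F = (\<chi> j. eval2 F (P j))"

definition E :: "('n::finite \<Rightarrow> 'a \<times> 'a) \<Rightarrow> nat \<Rightarrow> ('a::field ^ 'n) set" where
  "E P s = vec.span {ev P (M i) | i. i \<in> {1..s}}"

definition E_tilde :: "('n::finite \<Rightarrow> 'a \<times> 'a) \<Rightarrow> nat \<Rightarrow> ('a::field ^ 'n) set" where
  "E_tilde P \<delta> = vec.span {ev P (M i) | i. i \<in> {1..22} \<and> sigma i \<ge> \<delta>}"

definition C :: "('n::finite \<Rightarrow> 'a \<times> 'a) \<Rightarrow> nat \<Rightarrow> ('a::field ^ 'n) set" where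
  "C P s = dual_code (E P s)"

definition C_tilde :: "('n::finite \<Rightarrow> 'a \<times> 'a) \<Rightarrow> nat \<Rightarrow> ('a::field ^ 'n) set" where
  "C_tilde P \<delta> = dual_code (vec.span {ev P (M i) | i. i \<in> {1..22} \<and> mu i < \<delta>})"

end

theory Submission imports Defs
begin

text \<open>
  Over \<open>x \<noteq> 0\<close> the curve has three rational points, and their ordinates have power sums
  \<open>1, 0, 0, x, 0\<close>; hence, up to a correction for \<open>X\<^sup>7\<close>, the dual basis of the 22 evaluated
  monomials consists again of evaluated monomials. This gives all dimensions and turns the duals
  of the codes into spans of monomials.

  For most of the codes, an element is the evaluation of some
  \<open>F = p(X) + q(X) Y + r(X) Y\<^sup>2\<close>, and the number of its zeros is at most the degree of the norm of
  \<open>F\<close> over \<open>\<bbbF>\<^sub>8(X)\<close>, since the norm vanishes at \<open>x\<close> to at least the order given by the number of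
  zeros of \<open>F\<close> over \<open>x\<close>. The other codes are orthogonal to a few monomials of low degree, so that
  Vandermonde arguments along vertical and horizontal lines exclude words of small weight.
\<close>

subsection \<open>Dual codes of biorthogonal systems\<close>

text \<open>Two methods are needed because the norm estimate is not always sharp: the term-by-term
  degree bound \<open>norm_bound\<close> would give only weight 3 on E(17) and weight 5 on C(7),
  where 4 and 6 are required. The norm method itself rests on the norm of a nonzero triple (p, q, r)
  being nonzero, which holds because the curve polynomial is Eisenstein in Y at the prime X. All
  tuples but one follow from the minimum weights of the two larger codes. The exception is
  (1,15,4;E(5),E(4)): three points over one abscissa carry a nonzero word orthogonal to 1 and Y,
  hence to X and X^2, so the dual of E(4) has words of weight at most 3 and its bound 4 is a truly
  relative one.\<close>

definition bform :: "'a::comm_semiring_1 ^ 'n::finite \<Rightarrow> 'a ^ 'n \<Rightarrow> 'a" where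
  "bform u v = (\<Sum>i\<in>UNIV. u $ i * v $ i)"

lemma bform_commute: "bform u v = bform v u"
  by (simp add: bform_def mult.commute)

lemma bform_simps [simp]:
  fixes u v w :: "'a::field ^ 'n::finite"
  shows "bform u 0 = 0" "bform u (v + w) = bform u v + bform u w"
    "bform u (v - w) = bform u v - bform u w" "bform u (r *s v) = r * bform u v"
  by (simp_all add: bform_def algebra_simps sum.distrib sum_subtractf sum_distrib_left)

lemma bform_sum: "bform u (\<Sum>j\<in>J. c j *s v j) = (\<Sum>j\<in>J. c j * bform u (v j))"
  for u :: "'a::field ^ 'n::finite"
  by (induction J rule: infinite_finite_induct) auto

lemma in_dual_code_iff: "v \<in> dual_code D \<longleftrightarrow> (\<forall>c\<in>D. bform v c = 0)"
  by (simp add: dual_code_def bform_def)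

lemma in_dual_code_span_iff: "v \<in> dual_code (vec.span A) \<longleftrightarrow> (\<forall>c\<in>A. bform v c = 0)"
  for A :: "('a::field ^ 'n::finite) set"
proof
  assume v: "\<forall>c\<in>A. bform v c = 0"
  have "vec.span A \<subseteq> {c. bform v c = 0}"
    using v by (intro vec.span_minimal vec.subspaceI) auto
  then show "v \<in> dual_code (vec.span A)"
    by (auto simp: in_dual_code_iff)
qed (auto simp: in_dual_code_iff intro: vec.span_base)

text \<open>As \<open>J\<close> has as many elements as the space has dimensions, both families are
  bases, dual to each other. The symmetry \<open>flip\<close> transfers every fact about
  \<open>m\<close> to \<open>b\<close>.\<close>

locale biorthogonal =
  fixes m b :: "nat \<Rightarrow> 'a::field ^ 'n::finite" and J :: "nat set"
  assumes finite_J: "finite J" and card_J: "card J = CARD('n)"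
    and bform_m_b: "i \<in> J \<Longrightarrow> j \<in> J \<Longrightarrow> bform (m i) (b j) = (if i = j then 1 else 0)"
begin

lemma flip: "biorthogonal b m J"
  using finite_J card_J bform_m_b by unfold_locales (auto simp: bform_commute[of "b _"])

lemma inj_on_m: "inj_on m J"
  using bform_m_b by (intro inj_onI) (metis one_neq_zero)

text \<open>The vector \<open>b i\<close> separates: it is orthogonal to every \<open>m k\<close>
  with \<open>k\<close> in \<open>K\<close>, but pairs to 1 with \<open>m i\<close>.\<close>

lemma m_notin_span:
  assumes "i \<in> J" "K \<subseteq> J" "i \<notin> K"
  shows "m i \<notin> vec.span (m ` K)"
proof
  assume "m i \<in> vec.span (m ` K)"
  moreover have "b i \<in> dual_code (vec.span (m ` K))"
    using assms bform_m_b by (auto simp: in_dual_code_span_iff bform_commute[of "b _"])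
  ultimately have "bform (m i) (b i) = 0"
    by (auto simp: in_dual_code_iff bform_commute)
  with bform_m_b assms show False
    by simp
qed

lemma independent_m:
  assumes "I \<subseteq> J"
  shows "vec.independent (m ` I)"
proof
  assume "vec.dependent (m ` I)"
  then obtain i where i: "i \<in> I" "m i \<in> vec.span (m ` I - {m i})"
    by (auto simp: vec.dependent_def)
  have "m ` I - {m i} = m ` (I - {i})"
    using inj_on_m i(1) assms by (auto simp: inj_on_def)
  with i assms m_notin_span[of i "I - {i}"] show False
    by auto
qed

lemma dim_span_m:
  assumes "I \<subseteq> J"
  shows "vec.dim (vec.span (m ` I)) = card I"
  by (simp only: vec.dim_span vec.dim_eq_card_independent[OF independent_m[OF assms]])
     (simp add: card_image inj_on_subset[OF inj_on_m assms])

lemma span_m: "vec.span (m ` J) = UNIV"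
proof -
  have "(UNIV :: ('a ^ 'n) set) \<subseteq> vec.span (m ` J)"
    using card_J
    by (intro vec.card_ge_dim_independent independent_m)
       (auto simp: card_cart_basis card_image[OF inj_on_m])
  then show ?thesis
    by blast
qed

lemma expand:
  obtains u where "v = (\<Sum>j\<in>J. u j *s m j)"
proof -
  have "v \<in> vec.span (m ` J)"
    by (simp add: span_m)
  then obtain w where "v = (\<Sum>x\<in>m ` J. w x *s x)"
    by (auto simp: vec.span_finite[OF finite_imageI[OF finite_J]])
  then have "v = (\<Sum>j\<in>J. w (m j) *s m j)"
    by (simp add: sum.reindex[OF inj_on_m])
  with that show thesis .
qed

lemma dual_code_span_m:
  assumes "I \<subseteq> J"
  shows "dual_code (vec.span (m ` I)) = vec.span (b ` (J - I))"
proof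
  show "dual_code (vec.span (m ` I)) \<subseteq> vec.span (b ` (J - I))"
  proof
    fix v assume v: "v \<in> dual_code (vec.span (m ` I))"
    obtain u where u: "v = (\<Sum>j\<in>J. u j *s b j)"
      by (rule biorthogonal.expand[OF flip])
    \<comment> \<open>Pairing with \<open>m i\<close> reads off the coefficient of
      \<open>b i\<close>.\<close>
    have "u i = 0" if i: "i \<in> I" for i
    proof -
      have "0 = bform (m i) v"
        using v i by (auto simp: in_dual_code_span_iff bform_commute)
      also have "\<dots> = (\<Sum>j\<in>J. if i = j then u j else 0)"
        unfolding u bform_sum using i assms by (intro sum.cong) (auto simp: bform_m_b)
      also have "\<dots> = u i"
        using i assms by (simp add: finite_J subset_iff)
      finally show ?thesis ..
    qed
    then have "v = (\<Sum>j\<in>J - I. u j *s b j)"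
      unfolding u using finite_J by (intro sum.mono_neutral_right) auto
    then show "v \<in> vec.span (b ` (J - I))"
      by (simp only:) (intro vec.span_sum vec.span_scale vec.span_base imageI)
  qed
  have "b ` (J - I) \<subseteq> dual_code (vec.span (m ` I))"
    using assms bform_m_b by (auto simp: in_dual_code_span_iff bform_commute[of "b _"] subset_iff)
  moreover have "vec.subspace (dual_code (vec.span (m ` I)))"
    by (auto simp: vec.subspace_def in_dual_code_iff bform_commute)
  ultimately show "vec.span (b ` (J - I)) \<subseteq> dual_code (vec.span (m ` I))"
    by (intro vec.span_minimal)
qed

lemma dual_code_dual_code_span_m:
  assumes "I \<subseteq> J"
  shows "dual_code (dual_code (vec.span (m ` I))) = vec.span (m ` I)"
  using assms
  by (simp add: dual_code_span_m biorthogonal.dual_code_span_m[OF flip] double_diff)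

lemma css_bounds_span_m:
  fixes l dZ dX :: nat
  assumes sub: "I2 \<subset> I1" "I1 \<subseteq> J" and card: "card I1 = card I2 + l"
    and dZ: "\<And>c. c \<in> vec.span (m ` I1) \<Longrightarrow> c \<notin> vec.span (m ` I2) \<Longrightarrow> dZ \<le> hamming_weight c"
    and dX: "\<And>c. c \<in> dual_code (vec.span (m ` I2)) \<Longrightarrow> c \<notin> dual_code (vec.span (m ` I1))
                \<Longrightarrow> dX \<le> hamming_weight c"
    and fin: "finite (UNIV :: 'a set)"
  shows "css_bounds l dZ dX (vec.span (m ` I1)) (vec.span (m ` I2))"
proof -
  have fin': "finite A" for A :: "('a ^ 'n) set"
  proof -
    have "finite (range (\<lambda>v :: 'a ^ 'n. vec_nth v))"
      using finite_subset[OF _ finite_PiE[of "UNIV :: 'n set" "\<lambda>_. UNIV :: 'a set"]] fin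
      by (auto simp: PiE_UNIV_domain)
    then have "finite (UNIV :: ('a ^ 'n) set)"
      by (rule finite_imageD) (auto simp: inj_on_def vec_nth_inject)
    then show ?thesis
      by (rule rev_finite_subset) simp
  qed
  \<comment> \<open>For such an index, \<open>m i\<close> and \<open>b i\<close> witness that the
    two differences of codes are nonempty. Together with finiteness this makes both minima in
    \<open>rel_dist\<close> meaningful.\<close>
  obtain i where i: "i \<in> I1" "i \<notin> I2"
    using sub by blast
  have mi: "m i \<in> vec.span (m ` I1)" "m i \<notin> vec.span (m ` I2)"
    using i sub m_notin_span[of i I2] by (auto intro: vec.span_base)
  have bi: "b i \<in> dual_code (vec.span (m ` I2))" "b i \<notin> dual_code (vec.span (m ` I1))"
  proof -
    have "I2 \<subseteq> J" "i \<in> J - I2"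
      using i sub by auto
    then show "b i \<in> dual_code (vec.span (m ` I2))"
      by (simp only: dual_code_span_m) (intro vec.span_base imageI)
    show "b i \<notin> dual_code (vec.span (m ` I1))"
      unfolding dual_code_span_m[OF sub(2)]
      using i sub by (intro biorthogonal.m_notin_span[OF flip]) auto
  qed
  have "vec.span (m ` I2) \<subset> vec.span (m ` I1)"
    using mi sub vec.span_mono[of "m ` I2" "m ` I1"] by blast
  moreover have "rel_dist (vec.span (m ` I1)) (vec.span (m ` I2)) \<ge> dZ"
    unfolding rel_dist_def using mi dZ by (subst Min_ge_iff) (auto intro!: fin')
  moreover have "rel_dist (dual_code (vec.span (m ` I2))) (dual_code (vec.span (m ` I1))) \<ge> dX"
    unfolding rel_dist_def using bi dX by (subst Min_ge_iff) (auto intro!: fin')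
  moreover have "vec.dim (vec.span (m ` I1)) = card I1" "vec.dim (vec.span (m ` I2)) = card I2"
    using sub by (intro dim_span_m; auto)+
  ultimately show ?thesis
    using card by (simp add: css_bounds_def vec.subspace_span)
qed

end

subsection \<open>The points of the Klein quartic\<close>

lemma eval2_monomXY [simp]: "eval2 (monomXY a b) p = fst p ^ a * snd p ^ b"
  for p :: "'a::comm_ring_1 \<times> 'a"
  by (simp add: eval2_def monomXY_def poly_monom poly_power)

lemma klein_points_iff: "p \<in> klein_points \<longleftrightarrow> snd p ^ 3 + fst p ^ 3 * snd p + fst p = 0"
  for p :: "'a::comm_ring_1 \<times> 'a"
proof -
  have add: "eval2 (F + G) p = eval2 F p + eval2 G p" for F G :: "'a poly poly"
    by (simp add: eval2_def)
  show ?thesis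
    by (simp add: klein_points_def klein_quartic_def add)
qed

definition fibre :: "'a::comm_ring_1 \<Rightarrow> 'a set" where
  "fibre x = {y. y ^ 3 + x ^ 3 * y + x = 0}"

lemma klein_points_eq_Sigma: "klein_points = Sigma UNIV fibre"
  by (auto simp: klein_points_iff fibre_def)

lemma fibre_0 [simp]: "fibre (0 :: 'a::idom) = {0}"
  by (auto simp: fibre_def)

lemma finite_card_fibre:
  fixes x :: "'a::idom"
  shows "finite (fibre x)" "card (fibre x) \<le> 3"
proof -
  have eq: "fibre x = {y. poly [:x, x ^ 3, 0, 1:] y = 0}"
    by (auto simp: fibre_def algebra_simps power3_eq_cube)
  show "finite (fibre x)"
    unfolding eq by (rule poly_roots_finite) simp
  show "card (fibre x) \<le> 3"
    unfolding eq using card_poly_roots_bound[of "[:x, x ^ 3, 0, 1:]"] by simp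
qed

locale klein_code =
  fixes P :: "22 \<Rightarrow> 'a::{field,finite} \<times> 'a"
  assumes card_field: "CARD('a) = 8"
    and bij_P: "bij_betw P UNIV klein_points"
begin

text \<open>Translation by 1 permutes the field, so the sum of all elements does not change when 8
  ones are added; and 8 is a power of 2.\<close>

lemma two_eq_0: "(2 :: 'a) = 0"
proof -
  have "(\<Sum>x::'a\<in>UNIV. x + 1) = (\<Sum>x\<in>UNIV. x)"
    by (rule sum.reindex_bij_witness[of _ "\<lambda>x. x - 1" "\<lambda>x. x + 1"]) auto
  then have "(8 :: 'a) = 0"
    using card_field by (simp add: sum.distrib)
  then have "(2 :: 'a) ^ 3 = 0"
    by simp
  then show ?thesis
    by (simp only: power_eq_0_iff)
qed

lemma add_self: "x + x = (0 :: 'a)"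
  using two_eq_0 by (metis mult_2 mult_zero_left)

lemma uminus_eq: "- x = (x :: 'a)"
  using add_self by (metis add_eq_0_iff)

lemma power_7:
  assumes "x \<noteq> (0 :: 'a)"
  shows "x ^ 7 = 1"
proof -
  have "(\<Prod>y\<in>UNIV - {0}. x * y) = (\<Prod>y\<in>UNIV - {0}. y)"
    by (rule prod.reindex_bij_witness[of _ "\<lambda>y. y / x" "\<lambda>y. x * y"]) (use assms in auto)
  moreover have "card (UNIV - {0 :: 'a}) = 7"
    using card_field by (simp add: card_Diff_subset)
  ultimately have "x ^ 7 * (\<Prod>y\<in>UNIV - {0}. y) = (\<Prod>y\<in>UNIV - {0}. y)"
    by (simp add: prod.distrib)
  then show ?thesis
    by (simp add: prod_zero_iff)
qed

lemma sum_power_units: "(\<Sum>x\<in>UNIV - {0 :: 'a}. x ^ k) = (if 7 dvd k then 1 else 0)"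
proof (cases "7 dvd k")
  case True
  then obtain l where "k = 7 * l" ..
  then have "(\<Sum>x\<in>UNIV - {0 :: 'a}. x ^ k) = (\<Sum>x\<in>UNIV - {0 :: 'a}. 1)"
    by (intro sum.cong) (auto simp: power_mult power_7)
  also have "\<dots> = (7 :: 'a)"
    using card_field by (simp add: card_Diff_subset)
  also have "\<dots> = 2 * 3 + 1"
    by simp
  finally show ?thesis
    using True two_eq_0 by simp
next
  case False
  \<comment> \<open>The unit group has prime order 7, so every unit other than 1 has order 7; any
    such \<open>g\<close> satisfies \<open>g ^ k \<noteq> 1\<close>, and scaling by \<open>g\<close>
    then forces the sum to vanish.\<close>
  have "\<not> UNIV \<subseteq> {0, 1 :: 'a}"
    using card_field card_mono[of "{0, 1 :: 'a}" UNIV] by auto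
  then obtain g :: 'a where g: "g \<noteq> 0" "g \<noteq> 1"
    by auto
  have "g ^ k \<noteq> 1"
  proof
    assume gk: "g ^ k = 1"
    have "coprime k 7"
      using False prime_imp_coprime[of 7 k] by (auto simp: coprime_commute)
    then obtain u v where "k * u = 7 * v + 1"
      using coprime_bezout_strong[of k 7] by auto
    then have "g ^ (k * u) = g ^ (7 * v) * g"
      by simp
    then show False
      using g gk by (simp add: power_mult power_7)
  qed
  moreover have "(\<Sum>x\<in>UNIV - {0 :: 'a}. (g * x) ^ k) = (\<Sum>x\<in>UNIV - {0}. x ^ k)"
    by (rule sum.reindex_bij_witness[of _ "\<lambda>y. y / g" "\<lambda>y. g * y"]) (use g in auto)
  ultimately show ?thesis
    using False by (simp add: power_mult_distrib flip: sum_distrib_left)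
qed

text \<open>The 22 points consist of the origin and those over 7 nonzero abscissas with at most 3
  points each; as 22 = 1 + 7 * 3, no fibre can be smaller.\<close>

lemma card_fibre:
  assumes "x \<noteq> (0 :: 'a)"
  shows "card (fibre x) = 3"
proof (rule ccontr)
  assume "card (fibre x) \<noteq> 3"
  then have less: "card (fibre x) < 3"
    using finite_card_fibre(2)[of x] by simp
  have "22 = card (klein_points :: ('a \<times> 'a) set)"
    using bij_betw_same_card[OF bij_P] by simp
  also have "\<dots> = (\<Sum>x\<in>UNIV. card (fibre (x :: 'a)))"
    by (simp add: klein_points_eq_Sigma)
  also have "\<dots> = 1 + (\<Sum>x\<in>UNIV - {0}. card (fibre (x :: 'a)))"
    by (subst sum.remove[of _ 0]) auto
  also have "(\<Sum>x\<in>UNIV - {0}. card (fibre (x :: 'a))) < (\<Sum>x\<in>UNIV - {0 :: 'a}. 3)"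
    using assms less finite_card_fibre(2) by (intro sum_strict_mono_ex1) auto
  also have "\<dots> = 21"
    using card_field by (simp add: card_Diff_subset)
  finally show False
    by simp
qed

lemma fibre_power_sum:
  assumes x: "x \<noteq> (0 :: 'a)" and b: "b \<le> 4"
  shows "(\<Sum>y\<in>fibre x. y ^ b) = (if b = 0 then 1 else if b = 3 then x else 0)"
proof -
  obtain y1 y2 y3 where fib: "fibre x = {y1, y2, y3}" and dist: "y1 \<noteq> y2" "y1 \<noteq> y3" "y2 \<noteq> y3"
    using card_fibre[OF x] unfolding card_3_iff by auto
  have y: "y1 ^ 3 = - (x ^ 3) * y1 - x" "y2 ^ 3 = - (x ^ 3) * y2 - x" "y3 ^ 3 = - (x ^ 3) * y3 - x"
    using fib by (auto simp: fibre_def set_eq_iff eq_neg_iff_add_eq_0 algebra_simps)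
  have quad: "u\<^sup>2 + u * v + v\<^sup>2 + x ^ 3 = 0"
    if "u ^ 3 = - (x ^ 3) * u - x" "v ^ 3 = - (x ^ 3) * v - x" "u \<noteq> v" for u v
  proof -
    have "(u - v) * (u\<^sup>2 + u * v + v\<^sup>2 + x ^ 3) = (u ^ 3 + x ^ 3 * u) - (v ^ 3 + x ^ 3 * v)"
      by (simp add: algebra_simps power2_eq_square power3_eq_cube)
    then show ?thesis
      using that by simp
  qed
  \<comment> \<open>Two instances of \<open>quad\<close> sharing \<open>y1\<close> differ by this
    product, so the sum of the roots vanishes.\<close>
  have "(y2 - y3) * (y1 + y2 + y3) = (y1\<^sup>2 + y1 * y2 + y2\<^sup>2 + x ^ 3) - (y1\<^sup>2 + y1 * y3 + y3\<^sup>2 + x ^ 3)"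
    by (simp add: algebra_simps power2_eq_square)
  then have p1: "y1 + y2 + y3 = 0"
    using quad[of y1 y2] quad[of y1 y3] y dist by simp
  \<comment> \<open>Squaring is additive in characteristic 2, which yields the second and fourth
    power sums from the first.\<close>
  have sq: "u\<^sup>2 + v\<^sup>2 + w\<^sup>2 = (u + v + w)\<^sup>2" for u v w :: 'a
  proof -
    have "(u + v + w)\<^sup>2 = u\<^sup>2 + v\<^sup>2 + w\<^sup>2 + 2 * (u * v + u * w + v * w)"
      by (simp add: algebra_simps power2_eq_square)
    then show ?thesis
      by (simp add: two_eq_0)
  qed
  have p2: "y1\<^sup>2 + y2\<^sup>2 + y3\<^sup>2 = 0"
    by (simp add: sq p1)
  have p4: "y1 ^ 4 + y2 ^ 4 + y3 ^ 4 = 0"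
    using sq[of "y1\<^sup>2" "y2\<^sup>2" "y3\<^sup>2"] p2 by simp
  have "y1 ^ 3 + y2 ^ 3 + y3 ^ 3 = - (x ^ 3) * (y1 + y2 + y3) - 2 * x - x"
    unfolding y by (simp add: algebra_simps)
  then have p3: "y1 ^ 3 + y2 ^ 3 + y3 ^ 3 = x"
    by (simp add: p1 two_eq_0 uminus_eq)
  have p0: "1 + 1 + 1 = (1 :: 'a)"
    by (simp add: add_self)
  have "b = 0 \<or> b = 1 \<or> b = 2 \<or> b = 3 \<or> b = 4"
    using b by linarith
  then show ?thesis
    using p0 p1 p2 p3 p4 dist by (auto simp: fib add.assoc)
qed

lemma sum_points: "(\<Sum>j\<in>UNIV. f (P j)) = (\<Sum>x\<in>UNIV. \<Sum>y\<in>fibre x. f (x, y))"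
proof -
  have "(\<Sum>j\<in>UNIV. f (P j)) = (\<Sum>p\<in>klein_points. f p)"
    by (rule sum.reindex_bij_betw[OF bij_P])
  also have "\<dots> = (\<Sum>x\<in>UNIV. \<Sum>y\<in>fibre x. f (x, y))"
    by (simp add: klein_points_eq_Sigma sum.Sigma)
  finally show ?thesis .
qed

text \<open>This yields the Gram matrix of the monomials; products of two of them have Y-exponent at
  most 4.\<close>

lemma sum_points_monomial:
  assumes "b \<le> 4"
  shows "(\<Sum>j\<in>UNIV. fst (P j) ^ a * snd (P j) ^ b) =
    (if b = 0 \<and> a > 0 \<and> 7 dvd a \<or> b = 3 \<and> 7 dvd Suc a then 1 else 0)"
proof -
  have "(\<Sum>j\<in>UNIV. fst (P j) ^ a * snd (P j) ^ b) = (\<Sum>x\<in>UNIV. \<Sum>y\<in>fibre x. x ^ a * y ^ b)"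
    using sum_points[of "\<lambda>p. fst p ^ a * snd p ^ b"] by simp
  \<comment> \<open>The origin contributes 1 exactly for a = b = 0, where it cancels the sum over
    the units; hence the condition \<open>a > 0\<close>.\<close>
  also have "\<dots> = 0 ^ a * 0 ^ b + (\<Sum>x\<in>UNIV - {0}. x ^ a * (\<Sum>y\<in>fibre x. y ^ b))"
    by (subst sum.remove[of _ 0]) (auto simp: sum_distrib_left)
  also have "(\<Sum>x\<in>UNIV - {0 :: 'a}. x ^ a * (\<Sum>y\<in>fibre x. y ^ b)) =
      (\<Sum>x\<in>UNIV - {0}. if b = 0 then x ^ a else if b = 3 then x ^ Suc a else 0)"
  proof (intro sum.cong refl)
    fix x :: 'a assume "x \<in> UNIV - {0}"
    then show "x ^ a * (\<Sum>y\<in>fibre x. y ^ b) =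
        (if b = 0 then x ^ a else if b = 3 then x ^ Suc a else 0)"
      using fibre_power_sum[of x b] assms by simp
  qed
  also have "\<dots> = (if b = 0 \<and> 7 dvd a \<or> b = 3 \<and> 7 dvd Suc a then 1 else 0)"
    using sum_power_units[of a] sum_power_units[of "Suc a"]
    by (cases "b = 0"; cases "b = 3"; simp del: power_Suc)
  finally show ?thesis
    by (auto simp: add_self power_0_left)
qed

end

subsection \<open>Vanishing moments\<close>

text \<open>Summing against a polynomial of degree below \<open>n\<close> that vanishes at all
  values of \<open>u\<close> except \<open>a\<close> isolates the fibre over
  \<open>a\<close>.\<close>

lemma fibre_moments:
  fixes u w :: "'b \<Rightarrow> 'a::field"
  assumes fin: "finite S" and mom: "\<And>i. i < n \<Longrightarrow> (\<Sum>j\<in>S. w j * u j ^ i) = 0"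
    and card: "card (u ` S) \<le> n"
  shows "(\<Sum>j | j \<in> S \<and> u j = a. w j) = 0"
proof (cases "a \<in> u ` S")
  case True
  define f where "f = (\<Prod>b\<in>u ` S - {a}. [:- b, 1:])"
  have f_eq_0_iff: "poly f x = 0 \<longleftrightarrow> x \<in> u ` S - {a}" for x
    using fin by (auto simp: f_def poly_prod)
  have "degree f = card (u ` S - {a})"
    by (simp add: f_def degree_prod_eq_sum_degree)
  also have "\<dots> < n"
    using card_Diff1_less[OF finite_imageI[OF fin] True] card by linarith
  finally have deg: "degree f < n" .
  have "(\<Sum>j\<in>S. w j * poly f (u j)) = (\<Sum>j\<in>S. \<Sum>i\<le>degree f. coeff f i * (w j * u j ^ i))"
    by (simp add: poly_altdef sum_distrib_left mult_ac)
  also have "\<dots> = (\<Sum>i\<le>degree f. coeff f i * (\<Sum>j\<in>S. w j * u j ^ i))"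
    by (subst sum.swap) (simp add: sum_distrib_left)
  also have "\<dots> = 0"
    using deg mom by simp
  finally have "0 = (\<Sum>j\<in>S. w j * poly f (u j))" ..
  also have "\<dots> = (\<Sum>j | j \<in> S \<and> u j = a. w j * poly f (u j))"
    using fin f_eq_0_iff by (intro sum.mono_neutral_right) auto
  also have "\<dots> = (\<Sum>j | j \<in> S \<and> u j = a. w j) * poly f a"
    by (simp add: sum_distrib_right)
  finally show ?thesis
    using f_eq_0_iff[of a] by simp
qed (auto intro: sum.neutral)

text \<open>A value taken only once would, by \<open>fibre_moments\<close>, have weight 0 at its
  single point. So every value is taken at least twice.\<close>

lemma card_image_moments:
  fixes u w :: "'b \<Rightarrow> 'a::field"
  assumes fin: "finite S" and mom: "\<And>i. i < n \<Longrightarrow> (\<Sum>j\<in>S. w j * u j ^ i) = 0"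
    and card: "card (u ` S) \<le> n" and nz: "\<And>j. j \<in> S \<Longrightarrow> w j \<noteq> 0"
  shows "2 * card (u ` S) \<le> card S"
proof -
  have "2 \<le> card {j \<in> S. u j = a}" if a: "a \<in> u ` S" for a
  proof (rule ccontr)
    assume "\<not> 2 \<le> card {j \<in> S. u j = a}"
    moreover have "card {j \<in> S. u j = a} \<noteq> 0"
      using a fin by auto
    ultimately have "card {j \<in> S. u j = a} = 1"
      by linarith
    then obtain j where j: "{j \<in> S. u j = a} = {j}"
      by (auto simp: card_1_singleton_iff)
    then have "w j = 0"
      using fibre_moments[OF fin mom card, of a] by simp
    with nz j show False
      by auto
  qed
  then have "(\<Sum>a\<in>u ` S. 2) \<le> (\<Sum>a\<in>u ` S. card {j \<in> S. u j = a})"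
    by (intro sum_mono)
  also have "\<dots> = card S"
    using sum.image_gen[OF fin, of "\<lambda>_. 1 :: nat" u] by (simp only: card_eq_sum)
  finally show ?thesis
    by simp
qed

text \<open>This is the invertibility of a Vandermonde matrix: distinct nodes cannot each be hit
  twice.\<close>

lemma inj_moments_empty:
  fixes u w :: "'b \<Rightarrow> 'a::field"
  assumes "finite S" and "\<And>i. i < n \<Longrightarrow> (\<Sum>j\<in>S. w j * u j ^ i) = 0"
    and "card S \<le> n" and "\<And>j. j \<in> S \<Longrightarrow> w j \<noteq> 0" and "inj_on u S"
  shows "S = {}"
proof -
  have "2 * card (u ` S) \<le> card S"
    using assms by (intro card_image_moments[of S n w u]) (simp_all add: card_image)
  then show ?thesis
    using assms(1,5) by (simp add: card_image)
qed

lemma lagrange_interpolation: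
  fixes g :: "'a::field \<Rightarrow> 'a"
  assumes "finite S"
  shows "\<exists>q. (\<forall>k\<ge>card S. coeff q k = 0) \<and> (\<forall>x\<in>S. poly q x = g x)"
  using assms
proof (induction S rule: finite_induct)
  case empty
  show ?case
    by (rule exI[of _ 0]) simp
next
  case (insert s S)
  then obtain q where q: "\<forall>k\<ge>card S. coeff q k = 0" "\<forall>x\<in>S. poly q x = g x"
    by blast
  \<comment> \<open>Newton's form: a multiple of \<open>f\<close> corrects the value at
    \<open>s\<close> without disturbing those on \<open>S\<close>.\<close>
  define f where "f = (\<Prod>b\<in>S. [:- b, 1:])"
  have f0: "poly f x = 0 \<longleftrightarrow> x \<in> S" for x
    using insert by (auto simp: f_def poly_prod)
  have "degree f = card S"
    by (simp add: f_def degree_prod_eq_sum_degree)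
  with q(1) have "\<forall>k\<ge>card (insert s S). coeff (q + smult ((g s - poly q s) / poly f s) f) k = 0"
    using insert by (simp add: coeff_eq_0)
  moreover have "\<forall>x\<in>insert s S. poly (q + smult ((g s - poly q s) / poly f s) f) x = g x"
    using insert q(2) f0 by auto
  ultimately show ?case
    by blast
qed

section \<open>Words orthogonal to monomials of low degree\<close>

definition supp :: "'a::zero ^ 'n::finite \<Rightarrow> 'n set" where
  "supp v = {j. v $ j \<noteq> 0}"

context klein_code
begin

text \<open>Summing over the support only, where all weights are nonzero, matches the hypotheses of
  the vanishing-moment lemmas.\<close>

definition moment :: "'a ^ 22 \<Rightarrow> nat \<Rightarrow> nat \<Rightarrow> 'a" where
  "moment v a b = (\<Sum>j\<in>supp v. v $ j * (fst (P j) ^ a * snd (P j) ^ b))"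

lemma moment_eq_bform: "moment v a b = bform v (ev P (monomXY a b))"
  unfolding moment_def bform_def ev_def supp_def
  by (intro sum.mono_neutral_cong_left) auto

lemma point_on_curve: "snd (P j) ^ 3 + fst (P j) ^ 3 * snd (P j) + fst (P j) = 0"
  using bij_betwE[OF bij_P] by (simp flip: klein_points_iff)

lemma P_eqI: "fst (P i) = fst (P j) \<Longrightarrow> snd (P i) = snd (P j) \<Longrightarrow> i = j"
  using bij_betw_imp_inj_on[OF bij_P] by (metis injD prod_eqI)

lemma supp_eq_empty_iff: "supp v = {} \<longleftrightarrow> v = 0"
  by (auto simp: supp_def vec_eq_iff)

lemma card_le_1_D: "card (f ` S) \<le> 1 \<Longrightarrow> i \<in> S \<Longrightarrow> j \<in> S \<Longrightarrow> f i = f j"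
  for S :: "'b::finite set"
  using card_le_Suc0_iff_eq[OF finite_imageI[OF finite[of S]], of f] unfolding One_nat_def by blast

lemma vertical_support:
  assumes X: "card ((\<lambda>j. fst (P j)) ` supp v) \<le> 1"
    and mom: "\<And>i. i < n \<Longrightarrow> moment v 0 i = 0" and card: "card (supp v) \<le> n"
  shows "v = 0"
proof -
  have "inj_on (\<lambda>j. snd (P j)) (supp v)"
    using card_le_1_D[OF X] by (intro inj_onI P_eqI)
  then have "supp v = {}"
    using mom card
    by (intro inj_moments_empty[of "supp v" n "\<lambda>j. v $ j" "\<lambda>j. snd (P j)"])
       (auto simp: moment_def supp_def)
  then show ?thesis
    by (simp add: supp_eq_empty_iff)
qed

text \<open>On the line Y = c with c nonzero, X^i Y is a nonzero multiple of X^i, so a Vandermonde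
  argument in X applies. For c = 0 the curve leaves only the origin, where X^i vanishes for positive
  i. The form with X^i Y is needed because E(17) is orthogonal to XY and X^2 Y, but not to X and
  X^2.\<close>

lemma horizontal_support:
  assumes Y: "card ((\<lambda>j. snd (P j)) ` supp v) \<le> 1" and mom0: "moment v 0 0 = 0"
    and mom: "\<And>i. 0 < i \<Longrightarrow> i < n \<Longrightarrow> moment v i 1 = 0" and card: "card (supp v) \<le> n"
  shows "v = 0"
proof (rule ccontr)
  assume "v \<noteq> 0"
  then obtain j0 where j0: "j0 \<in> supp v"
    by (auto simp flip: supp_eq_empty_iff)
  have Y': "snd (P j) = snd (P j0)" if "j \<in> supp v" for j
    using card_le_1_D[OF Y that j0] .
  have "inj_on (\<lambda>j. fst (P j)) (supp v)"
    using Y' by (auto intro!: inj_onI P_eqI)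
  moreover have "(\<Sum>j\<in>supp v. v $ j * fst (P j) ^ i) = 0" if "i < n" for i
  proof (cases "i = 0")
    case True
    then show ?thesis
      using mom0 by (simp add: moment_def)
  next
    case i: False
    show ?thesis
    proof (cases "snd (P j0) = 0")
      case True
      then have "fst (P j) = 0" if "j \<in> supp v" for j
        using Y'[OF that] point_on_curve[of j] by simp
      with i show ?thesis
        by (simp add: power_0_left)
    next
      case False
      have "moment v i 1 = (\<Sum>j\<in>supp v. v $ j * fst (P j) ^ i) * snd (P j0)"
        unfolding moment_def sum_distrib_right by (intro sum.cong) (auto simp: Y')
      with mom[of i] i that False show ?thesis
        by simp
    qed
  qed
  ultimately have "supp v = {}"
    using card
    by (intro inj_moments_empty[of "supp v" n "\<lambda>j. v $ j" "\<lambda>j. fst (P j)"]) (auto simp: supp_def)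
  with j0 show False
    by simp
qed

lemma card_fst_supp:
  assumes "\<And>i. i < n \<Longrightarrow> moment v i 0 = 0" and "card ((\<lambda>j. fst (P j)) ` supp v) \<le> n"
  shows "2 * card ((\<lambda>j. fst (P j)) ` supp v) \<le> card (supp v)"
proof (rule card_image_moments[of "supp v" n "\<lambda>j. v $ j"])
  show "(\<Sum>j\<in>supp v. v $ j * fst (P j) ^ i) = 0" if "i < n" for i
    using assms(1)[OF that] by (simp add: moment_def)
qed (rule finite, rule assms(2), simp add: supp_def)

lemma card_snd_supp:
  assumes "\<And>i. i < n \<Longrightarrow> moment v 0 i = 0" and "card ((\<lambda>j. snd (P j)) ` supp v) \<le> n"
  shows "2 * card ((\<lambda>j. snd (P j)) ` supp v) \<le> card (supp v)"
proof (rule card_image_moments[of "supp v" n "\<lambda>j. v $ j"])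
  show "(\<Sum>j\<in>supp v. v $ j * snd (P j) ^ i) = 0" if "i < n" for i
    using assms(1)[OF that] by (simp add: moment_def)
qed (rule finite, rule assms(2), simp add: supp_def)

lemma card_image_supp: "card (f ` supp v) \<le> card (supp v)"
  by (rule card_image_le) simp

lemma less_2_3_4_iff:
  "i < (2::nat) \<longleftrightarrow> i = 0 \<or> i = 1" "i < (3::nat) \<longleftrightarrow> i = 0 \<or> i = 1 \<or> i = 2"
  "i < (4::nat) \<longleftrightarrow> i = 0 \<or> i = 1 \<or> i = 2 \<or> i = 3"
  by (simp_all add: numeral_eq_Suc less_Suc_eq disj_ac)

lemma hamming_weight_eq: "hamming_weight v = card (supp v)"
  by (simp add: hamming_weight_def supp_def)

lemma weight_ge_2:
  assumes "moment v 0 0 = 0" "v \<noteq> 0"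
  shows "2 \<le> hamming_weight v"
proof (rule ccontr)
  assume "\<not> 2 \<le> hamming_weight v"
  then have wt: "card (supp v) \<le> 1"
    by (simp add: hamming_weight_eq)
  then have "v = 0"
    using assms(1) card_image_supp[of "\<lambda>j. fst (P j)" v] by (intro vertical_support[of v 1]) auto
  with assms show False
    by simp
qed

text \<open>In a support of at most 2 points every abscissa must occur twice, so there is just one,
  and on a vertical line Y has distinct values. The bounds up to
  \<open>weight_ge_4_horizontal\<close> vary this: a support of at most 3 points still admits only
  one repeated coordinate value.\<close>

lemma weight_ge_3_line:
  assumes "moment v 0 0 = 0" "moment v 1 0 = 0" "moment v 0 1 = 0" "v \<noteq> 0"
  shows "3 \<le> hamming_weight v"
proof (rule ccontr)
  assume "\<not> 3 \<le> hamming_weight v"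
  then have wt: "card (supp v) \<le> 2"
    by (simp add: hamming_weight_eq)
  have "2 * card ((\<lambda>j. fst (P j)) ` supp v) \<le> card (supp v)"
    using assms wt card_image_supp[of "\<lambda>j. fst (P j)" v]
    by (intro card_fst_supp[of 2]) (auto simp: less_2_3_4_iff)
  with wt assms have "v = 0"
    by (intro vertical_support[of v 2]) (auto simp: less_2_3_4_iff)
  with assms show False
    by simp
qed

lemma weight_ge_3_horizontal:
  assumes "moment v 0 0 = 0" "moment v 0 1 = 0" "moment v 1 1 = 0" "v \<noteq> 0"
  shows "3 \<le> hamming_weight v"
proof (rule ccontr)
  assume "\<not> 3 \<le> hamming_weight v"
  then have wt: "card (supp v) \<le> 2"
    by (simp add: hamming_weight_eq)
  have "2 * card ((\<lambda>j. snd (P j)) ` supp v) \<le> card (supp v)"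
    using assms wt card_image_supp[of "\<lambda>j. snd (P j)" v]
    by (intro card_snd_supp[of 2]) (auto simp: less_2_3_4_iff)
  with wt assms have "v = 0"
    by (intro horizontal_support[of v 2]) (auto simp: less_2_3_4_iff)
  with assms show False
    by simp
qed

lemma weight_ge_4_vertical:
  assumes "moment v 0 0 = 0" "moment v 1 0 = 0" "moment v 2 0 = 0"
    "moment v 0 1 = 0" "moment v 0 2 = 0" "v \<noteq> 0"
  shows "4 \<le> hamming_weight v"
proof (rule ccontr)
  assume "\<not> 4 \<le> hamming_weight v"
  then have wt: "card (supp v) \<le> 3"
    by (simp add: hamming_weight_eq)
  have "2 * card ((\<lambda>j. fst (P j)) ` supp v) \<le> card (supp v)"
    using assms wt card_image_supp[of "\<lambda>j. fst (P j)" v]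
    by (intro card_fst_supp[of 3]) (auto simp: less_2_3_4_iff)
  with wt assms have "v = 0"
    by (intro vertical_support[of v 3]) (auto simp: less_2_3_4_iff)
  with assms show False
    by simp
qed

lemma weight_ge_4_horizontal:
  assumes "moment v 0 0 = 0" "moment v 0 1 = 0" "moment v 0 2 = 0"
    "moment v 1 1 = 0" "moment v 2 1 = 0" "v \<noteq> 0"
  shows "4 \<le> hamming_weight v"
proof (rule ccontr)
  assume "\<not> 4 \<le> hamming_weight v"
  then have wt: "card (supp v) \<le> 3"
    by (simp add: hamming_weight_eq)
  have "2 * card ((\<lambda>j. snd (P j)) ` supp v) \<le> card (supp v)"
    using assms wt card_image_supp[of "\<lambda>j. snd (P j)" v]
    by (intro card_snd_supp[of 3]) (auto simp: less_2_3_4_iff)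
  with wt assms have "v = 0"
    by (intro horizontal_support[of v 3]) (auto simp: less_2_3_4_iff)
  with assms show False
    by simp
qed

text \<open>A word of weight at most 3 killed by \<open>1, X, X\<^sup>2\<close> is supported on a vertical line, where
  \<open>XY\<close> is a multiple of \<open>Y\<close>.\<close>

lemma weight_ge_4_relative:
  assumes "moment v 0 0 = 0" "moment v 1 0 = 0" "moment v 2 0 = 0"
    "moment v 0 1 = 0" "moment v 1 1 \<noteq> 0"
  shows "4 \<le> hamming_weight v"
proof (rule ccontr)
  assume "\<not> 4 \<le> hamming_weight v"
  then have wt: "card (supp v) \<le> 3"
    by (simp add: hamming_weight_eq)
  have "2 * card ((\<lambda>j. fst (P j)) ` supp v) \<le> card (supp v)"
    using assms wt card_image_supp[of "\<lambda>j. fst (P j)" v]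
    by (intro card_fst_supp[of 3]) (auto simp: less_2_3_4_iff)
  then have X: "card ((\<lambda>j. fst (P j)) ` supp v) \<le> 1"
    using wt by linarith
  obtain j0 where j0: "j0 \<in> supp v"
    using assms(5) by (auto simp: moment_def intro: sum.neutral)
  have "fst (P j) = fst (P j0)" if "j \<in> supp v" for j
    using card_le_1_D[OF X that j0] .
  then have "moment v 1 1 = moment v 0 1 * fst (P j0)"
    unfolding moment_def sum_distrib_right by (intro sum.cong) auto
  with assms show False
    by simp
qed

lemma not_all_on_line:
  assumes "\<And>j. j \<in> S \<Longrightarrow> snd (P j) = c0 + c1 * fst (P j)" and "inj_on (\<lambda>j. fst (P j)) S"
  shows "card S \<le> 4"
proof (rule ccontr)
  assume "\<not> card S \<le> 4"
  define h where "h = [:c0 ^ 3, 3 * c0\<^sup>2 * c1 + 1, 3 * c0 * c1\<^sup>2, c1 ^ 3 + c0, c1:]"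
  have "poly h (fst (P j)) = 0" if "j \<in> S" for j
    using point_on_curve[of j] unfolding assms(1)[OF that]
    by (simp add: h_def algebra_simps power2_eq_square power3_eq_cube)
  then have "(\<lambda>j. fst (P j)) ` S \<subseteq> {x. poly h x = 0}"
    by auto
  then have "card S \<le> card {x. poly h x = 0}"
    using assms(2) by (metis card_image card_mono finite)
  moreover have "degree h \<le> 4"
    by (simp add: h_def)
  ultimately have "h = 0"
    using card_poly_roots_bound[of h] \<open>\<not> card S \<le> 4\<close> by linarith
  \<comment> \<open>If \<open>h\<close> were 0, its leading coefficient would give
    \<open>c1 = 0\<close>, but then the coefficient of X is 1.\<close>
  then show False
    by (auto simp: h_def)
qed

text \<open>A support of at most 5 points either has repeated abscissas, and then collapses to a
  single vertical line, or has 5 distinct ones, and then the conditions for Y, XY and Y^2 force it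
  onto a line Y = c0 + c1 X, which meets the curve in at most 4 points.\<close>

lemma weight_ge_6:
  assumes mom: "moment v 0 0 = 0" "moment v 1 0 = 0" "moment v 2 0 = 0" "moment v 3 0 = 0"
    "moment v 0 1 = 0" "moment v 1 1 = 0" "moment v 0 2 = 0" and v: "v \<noteq> 0"
  shows "6 \<le> hamming_weight v"
proof (rule ccontr)
  define S where "S = supp v"
  define X where "X = (\<lambda>j. fst (P j))"
  assume "\<not> 6 \<le> hamming_weight v"
  then have wt: "card S \<le> 5"
    by (simp add: hamming_weight_eq S_def)
  have nz: "v $ j \<noteq> 0" if "j \<in> S" for j
    using that by (simp add: S_def supp_def)
  have momX: "(\<Sum>j\<in>S. v $ j * X j ^ i) = 0" if "i < 4" for i
    using that mom by (auto simp: moment_def S_def X_def less_2_3_4_iff)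
  have momXY: "(\<Sum>j\<in>S. v $ j * snd (P j) * X j ^ i) = 0" if "i < 2" for i
    using that mom by (auto simp: moment_def S_def X_def less_2_3_4_iff mult_ac)
  show False
  proof (cases "card (X ` S) \<le> 4")
    case True
    have "2 * card (X ` S) \<le> card S"
      using True momX nz by (intro card_image_moments[of S 4 "\<lambda>j. v $ j"]) auto
    then have card2: "card (X ` S) \<le> 2"
      using wt by linarith
    \<comment> \<open>With at most two abscissas, the conditions for 1, X and for Y, XY split
      fibrewise: on each fibre the moments of 1 and Y vanish, which excludes fibres of one or two
      points.\<close>
    have ge3: "3 \<le> card {j \<in> S. X j = a}" if a: "a \<in> X ` S" for a
    proof (rule ccontr)
      assume *: "\<not> 3 \<le> card {j \<in> S. X j = a}"
      have 0: "(\<Sum>j | j \<in> S \<and> X j = a. v $ j) = 0"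
        using momX True by (intro fibre_moments[of S 4]) auto
      have 1: "(\<Sum>j | j \<in> S \<and> X j = a. v $ j * snd (P j)) = 0"
        using momXY card2 by (intro fibre_moments[of S 2]) auto
      have "inj_on (\<lambda>j. snd (P j)) {j \<in> S. X j = a}"
        by (auto intro!: inj_onI P_eqI simp: X_def)
      with * 0 1 nz have "{j \<in> S. X j = a} = {}"
        by (intro inj_moments_empty[of _ 2 "\<lambda>j. v $ j" "\<lambda>j. snd (P j)"]) (auto simp: less_2_3_4_iff)
      with a show False
        by auto
    qed
    have "3 * card (X ` S) = (\<Sum>a\<in>X ` S. 3)"
      by simp
    also have "\<dots> \<le> (\<Sum>a\<in>X ` S. card {j \<in> S. X j = a})"
      using ge3 by (intro sum_mono)
    also have "\<dots> = card S"
      using sum.image_gen[of S "\<lambda>_. 1 :: nat" X] by (simp only: card_eq_sum finite)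
    finally have card1: "card (X ` S) \<le> 1"
      using wt by linarith
    moreover have "card S \<le> 3"
    proof (cases "S = {}")
      case False
      then obtain j0 where j0: "j0 \<in> S"
        by auto
      have eq: "X j = X j0" if "j \<in> S" for j
        using card_le_1_D[OF card1 that j0] .
      have "inj_on (\<lambda>j. snd (P j)) S"
        using eq by (auto intro!: inj_onI P_eqI simp: X_def)
      moreover have "(\<lambda>j. snd (P j)) ` S \<subseteq> fibre (X j0)"
        using point_on_curve eq by (auto simp: fibre_def X_def) metis
      ultimately have "card S \<le> card (fibre (X j0))"
        by (metis card_image card_mono finite)
      also have "\<dots> \<le> 3"
        by (rule finite_card_fibre)
      finally show ?thesis .
    qed simp
    ultimately have "v = 0"
      using mom by (intro vertical_support[of v 3]) (auto simp: S_def X_def less_2_3_4_iff)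
    with v show False ..
  next
    case False
    have "card (X ` S) \<le> card S"
      by (rule card_image_le) simp
    with False wt have card: "card (X ` S) = card S" "card S = 5"
      by (simp_all add: numeral_eq_Suc less_Suc_eq disj_ac)
    then have inj: "inj_on X S"
      by (intro eq_card_imp_inj_on) auto
    define m4 where "m4 = (\<Sum>j\<in>S. v $ j * X j ^ 4)"
    have "m4 \<noteq> 0"
    proof
      assume "m4 = 0"
      then have "(\<Sum>j\<in>S. v $ j * X j ^ i) = 0" if "i < 5" for i
        using that momX[of i] by (cases "i = 4") (auto simp: m4_def)
      then have "S = {}"
        using inj card nz by (intro inj_moments_empty[of S 5 "\<lambda>j. v $ j" X]) auto
      with card show False
        by simp
    qed
    \<comment> \<open>As the moments of 1, X, X^2, X^3 vanish, summation against the word only sees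
      the coefficient of X^4 in a polynomial of degree at most 4.\<close>
    have eval: "(\<Sum>j\<in>S. v $ j * poly f (X j)) = coeff f 4 * m4" if "\<forall>k\<ge>5. coeff f k = 0" for f
    proof -
      have f: "poly f x = (\<Sum>i<5. coeff f i * x ^ i)" for x
      proof -
        have "(\<Sum>i<5. coeff f i * x ^ i) = (\<Sum>i\<le>max 5 (degree f). coeff f i * x ^ i)"
          using that by (intro sum.mono_neutral_left) auto
        also have "\<dots> = poly f x"
          unfolding poly_altdef using coeff_eq_0[of f]
          by (intro sum.mono_neutral_right) auto
        finally show ?thesis ..
      qed
      have "(\<Sum>j\<in>S. v $ j * poly f (X j)) = (\<Sum>j\<in>S. \<Sum>i<5. coeff f i * (v $ j * X j ^ i))"
        by (simp only: f sum_distrib_left mult_ac)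
      also have "\<dots> = (\<Sum>i<5. coeff f i * (\<Sum>j\<in>S. v $ j * X j ^ i))"
        by (subst sum.swap) (simp only: sum_distrib_left)
      also have "\<dots> = (\<Sum>i\<in>{4}. coeff f i * (\<Sum>j\<in>S. v $ j * X j ^ i))"
        using momX by (intro sum.mono_neutral_right) auto
      finally show ?thesis
        by (simp add: m4_def)
    qed
    obtain q where q: "\<forall>k\<ge>5. coeff q k = 0" "\<forall>x\<in>X ` S. poly q x = snd (P (the_inv_into S X x))"
      using lagrange_interpolation[of "X ` S" "\<lambda>x. snd (P (the_inv_into S X x))"] card by auto
    have Y: "snd (P j) = poly q (X j)" if "j \<in> S" for j
      using q(2) that inj by (simp add: the_inv_into_f_f)
    \<comment> \<open>Orthogonality to Y, XY and Y^2 removes in turn the coefficients 4, 3 and 2 of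
      the interpolant; the coefficient of X^4 in \<open>q * q\<close> is by then the square of
      \<open>coeff q 2\<close>.\<close>
    have "coeff q 4 * m4 = (\<Sum>j\<in>S. v $ j * snd (P j))"
      using Y by (simp add: eval[OF q(1), symmetric])
    then have q4: "coeff q 4 = 0"
      using momXY[of 0] \<open>m4 \<noteq> 0\<close> by simp
    then have q_ge_4: "coeff q k = 0" if "k \<ge> 4" for k
      using q(1) that by (cases "k = 4") auto
    have "coeff (pCons 0 q) 4 * m4 = (\<Sum>j\<in>S. v $ j * snd (P j) * X j)"
      using Y q_ge_4 by (subst eval[symmetric]) (auto simp: coeff_pCons mult_ac split: nat.split)
    then have q3: "coeff q 3 = 0"
      using momXY[of 1] \<open>m4 \<noteq> 0\<close> by (simp add: coeff_pCons numeral_eq_Suc)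
    have q_eq: "q = [:coeff q 0, coeff q 1, coeff q 2:]"
    proof (rule poly_eqI)
      fix k
      show "coeff q k = coeff [:coeff q 0, coeff q 1, coeff q 2:] k"
        using q_ge_4[of k] q3 by (cases "k < 4") (auto simp: less_2_3_4_iff coeff_pCons numeral_eq_Suc split: nat.split)
    qed
    have "coeff (q * q) 4 * m4 = (\<Sum>j\<in>S. v $ j * (snd (P j))\<^sup>2)"
    proof (subst eval[symmetric])
      have "degree q \<le> 2"
        by (subst q_eq) simp
      then have "degree (q * q) < 5"
        using degree_mult_le[of q q] by linarith
      then show "\<forall>k\<ge>5. coeff (q * q) k = 0"
        by (auto intro: coeff_eq_0)
    qed (simp add: Y power2_eq_square)
    then have "coeff (q * q) 4 = 0"
      using mom(7) \<open>m4 \<noteq> 0\<close> by (simp add: moment_def S_def)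
    then have "coeff q 2 = 0"
      by (subst (asm) (1 2) q_eq) (simp add: coeff_pCons numeral_eq_Suc)
    then have "snd (P j) = coeff q 0 + coeff q 1 * fst (P j)" if "j \<in> S" for j
      using Y[OF that] by (subst (asm) q_eq) (simp add: X_def mult.commute)
    then have "card S \<le> 4"
      using inj by (intro not_all_on_line) (auto simp: X_def)
    with card show False
      by simp
  qed
qed

end

subsection \<open>The norm of a function on the Klein quartic\<close>

definition feval :: "'a::comm_ring_1 poly \<Rightarrow> 'a poly \<Rightarrow> 'a poly \<Rightarrow> 'a \<times> 'a \<Rightarrow> 'a" where
  "feval p q r z = poly p (fst z) + poly q (fst z) * snd z + poly r (fst z) * (snd z)\<^sup>2"

text \<open>The rows are the coordinates of F, Y F and Y^2 F in the basis 1, Y, Y^2, for F = p + q Y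
  + r Y^2 and Y^3 reduced to - X^3 Y - X.\<close>

definition mult_matrix :: "'a::comm_ring_1 poly \<Rightarrow> 'a poly \<Rightarrow> 'a poly \<Rightarrow> 'a poly ^ 3 ^ 3" where
  "mult_matrix p q r =
     (let X = [:0, 1:] in
      vector [vector [p, q, r],
              vector [- (X * r), p - X ^ 3 * r, q],
              vector [- (X * q), - (X * r) - X ^ 3 * q, p - X ^ 3 * r]])"

definition norm_poly :: "'a::comm_ring_1 poly \<Rightarrow> 'a poly \<Rightarrow> 'a poly \<Rightarrow> 'a poly" where
  "norm_poly p q r = det (mult_matrix p q r)"

lemma norm_poly_eq:
  "norm_poly p q r =
     p ^ 3 - 2 * [:0, 1:] ^ 3 * p\<^sup>2 * r + [:0, 1:] ^ 6 * p * r\<^sup>2 + 3 * [:0, 1:] * p * q * r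
     + [:0, 1:] ^ 3 * p * q\<^sup>2 - [:0, 1:] * q ^ 3 + [:0, 1:]\<^sup>2 * r ^ 3 - [:0, 1:] ^ 4 * q * r\<^sup>2"
proof -
  \<comment> \<open>An opaque \<open>X\<close> keeps the simplifier from multiplying out the
    explicit polynomial.\<close>
  have "norm_poly p q r =
     p ^ 3 - 2 * X ^ 3 * p\<^sup>2 * r + X ^ 6 * p * r\<^sup>2 + 3 * X * p * q * r
     + X ^ 3 * p * q\<^sup>2 - X * q ^ 3 + X\<^sup>2 * r ^ 3 - X ^ 4 * q * r\<^sup>2" if X: "X = [:0, 1:]" for X
    unfolding norm_poly_def mult_matrix_def Let_def det_3 X[symmetric]
    by (simp add: vector_3 algebra_simps eval_nat_numeral)
  then show ?thesis
    by blast
qed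

lemma norm_poly_mult: "norm_poly (s * p) (s * q) (s * r) = s ^ 3 * norm_poly p q r"
  by (simp add: norm_poly_eq algebra_simps power_mult_distrib)
     (simp add: power2_eq_square power3_eq_cube mult_ac)

text \<open>Descent at the prime X: modulo X the norm is p^3, so X divides p. After cancelling X,
  the only term left without X is - q^3, and one round later r^3. By homogeneity the triple of
  quotients again has norm 0, with smaller total degree unless it is zero.\<close>

lemma norm_poly_eq_0:
  fixes p q r :: "'a::idom poly"
  assumes "norm_poly p q r = 0"
  shows "p = 0 \<and> q = 0 \<and> r = 0"
  using assms
proof (induction "degree p + degree q + degree r" arbitrary: p q r rule: less_induct)
  case less
  have "poly (norm_poly p q r) 0 = poly p 0 ^ 3"
    by (simp add: norm_poly_eq)
  then have "poly p 0 = 0"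
    using less.prems by simp
  then obtain p' where p: "p = [:0, 1:] * p'"
    by (auto simp: poly_eq_0_iff_dvd)
  have "norm_poly p q r = [:0, 1:] * ([:0, 1:]\<^sup>2 * p' ^ 3 - 2 * [:0, 1:] ^ 4 * p'\<^sup>2 * r
      + [:0, 1:] ^ 6 * p' * r\<^sup>2 + 3 * [:0, 1:] * p' * q * r
      + [:0, 1:] ^ 3 * p' * q\<^sup>2 - q ^ 3 + [:0, 1:] * r ^ 3 - [:0, 1:] ^ 3 * q * r\<^sup>2)"
    unfolding norm_poly_eq p by algebra
  then have norm1: "[:0, 1:]\<^sup>2 * p' ^ 3 - 2 * [:0, 1:] ^ 4 * p'\<^sup>2 * r
      + [:0, 1:] ^ 6 * p' * r\<^sup>2 + 3 * [:0, 1:] * p' * q * r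
      + [:0, 1:] ^ 3 * p' * q\<^sup>2 - q ^ 3 + [:0, 1:] * r ^ 3 - [:0, 1:] ^ 3 * q * r\<^sup>2 = 0"
    (is "?N1 = 0")
    using less.prems by (metis mult_eq_0_iff pCons_eq_0_iff zero_neq_one)
  have "poly ?N1 0 = - (poly q 0 ^ 3)"
    by simp
  then have "poly q 0 = 0"
    unfolding norm1 by simp
  then obtain q' where q: "q = [:0, 1:] * q'"
    by (auto simp: poly_eq_0_iff_dvd)
  have "?N1 = [:0, 1:] * ([:0, 1:] * p' ^ 3 - 2 * [:0, 1:] ^ 3 * p'\<^sup>2 * r
      + [:0, 1:] ^ 5 * p' * r\<^sup>2 + 3 * [:0, 1:] * p' * q' * r
      + [:0, 1:] ^ 4 * p' * q'\<^sup>2 - [:0, 1:]\<^sup>2 * q' ^ 3 + r ^ 3 - [:0, 1:] ^ 3 * q' * r\<^sup>2)"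
    unfolding q by algebra
  then have norm2: "[:0, 1:] * p' ^ 3 - 2 * [:0, 1:] ^ 3 * p'\<^sup>2 * r
      + [:0, 1:] ^ 5 * p' * r\<^sup>2 + 3 * [:0, 1:] * p' * q' * r
      + [:0, 1:] ^ 4 * p' * q'\<^sup>2 - [:0, 1:]\<^sup>2 * q' ^ 3 + r ^ 3 - [:0, 1:] ^ 3 * q' * r\<^sup>2 = 0"
    (is "?N2 = 0")
    using norm1 by (metis mult_eq_0_iff pCons_eq_0_iff zero_neq_one)
  have "poly ?N2 0 = poly r 0 ^ 3"
    by simp
  then have "poly r 0 = 0"
    unfolding norm2 by simp
  then obtain r' where r: "r = [:0, 1:] * r'"
    by (auto simp: poly_eq_0_iff_dvd)
  have norm': "norm_poly p' q' r' = 0"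
    using less.prems unfolding p q r norm_poly_mult by simp
  have deg: "degree ([:0, 1:] * s) = (if s = 0 then 0 else Suc (degree s))" for s :: "'a poly"
    by (simp add: degree_pCons_eq_if)
  show ?case
  proof (cases "p' = 0 \<and> q' = 0 \<and> r' = 0")
    case False
    then have "degree p' + degree q' + degree r' < degree p + degree q + degree r"
      unfolding p q r deg by auto
    from less.hyps[OF this norm'] False show ?thesis
      by blast
  qed (simp add: p q r)
qed

lemma dvd_det_3:
  fixes A :: "'a::comm_ring_1 ^ 3 ^ 3"
  assumes "\<And>i. d1 dvd A $ i $ 1" "\<And>i. d2 dvd A $ i $ 2" "\<And>i. d3 dvd A $ i $ 3"
  shows "d1 * d2 * d3 dvd det A"
proof -
  obtain e1 e2 e3 where e: "A $ i $ 1 = d1 * e1 i" "A $ i $ 2 = d2 * e2 i" "A $ i $ 3 = d3 * e3 i" for i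
    using assms unfolding dvd_def by metis
  have "det A = d1 * d2 * d3 *
      (e1 1 * e2 2 * e3 3 + e2 1 * e3 2 * e1 3 + e3 1 * e1 2 * e2 3
       - e1 1 * e3 2 * e2 3 - e2 1 * e1 2 * e3 3 - e3 1 * e2 2 * e1 3)"
    unfolding det_3 e by (simp add: algebra_simps)
  then show ?thesis
    by simp
qed

text \<open>With \<open>y\<^sub>1, y\<^sub>2, y\<^sub>3\<close> the points over \<open>x\<close>, the constant matrix with columns
  \<open>(1, y\<^sub>i, y\<^sub>i\<^sup>2)\<close> diagonalises multiplication by the function modulo \<open>X - x\<close>.\<close>

lemma dvd_norm_poly:
  fixes x :: "'a::field" and p q r :: "'a poly"
  assumes fibre: "y1 \<in> fibre x" "y2 \<in> fibre x" "y3 \<in> fibre x"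
    and dist: "y1 \<noteq> y2" "y1 \<noteq> y3" "y2 \<noteq> y3"
  defines "d \<equiv> \<lambda>y. if feval p q r (x, y) = 0 then [:- x, 1:] else 1"
  shows "d y1 * d y2 * d y3 dvd norm_poly p q r"
proof -
  define V :: "'a poly ^ 3 ^ 3" where
    "V = vector [vector [1, 1, 1], vector [[:y1:], [:y2:], [:y3:]],
                 vector [[:y1:]\<^sup>2, [:y2:]\<^sup>2, [:y3:]\<^sup>2]]"
  define \<delta> where "\<delta> = (y2 - y1) * (y3 - y1) * (y3 - y2)"
  have detV: "det V = [:\<delta>:]"
    by (simp add: V_def det_3 vector_3 \<delta>_def power2_eq_square algebra_simps)
  have dvd1: "d y dvd p + q * [:y:] + r * [:y:]\<^sup>2" for y
    by (auto simp: d_def feval_def mult.commute simp flip: poly_eq_0_iff_dvd)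
  have dvd2: "d y dvd [:y:] ^ 3 + [:0, 1:] ^ 3 * [:y:] + [:0, 1:]" if "y \<in> fibre x" for y
    using that by (auto simp: d_def fibre_def mult.commute simp flip: poly_eq_0_iff_dvd)
  \<comment> \<open>Row 2 applied to (1, Y, Y^2) is Y F up to a multiple of the curve polynomial,
    whose value at \<open>Y = y\<close> is divisible by X - x; \<open>row3\<close> does the same for
    Y^2 F.\<close>
  have row2: "- ([:0, 1:] * r) + (p - [:0, 1:] ^ 3 * r) * Y + q * Y\<^sup>2 =
      Y * (p + q * Y + r * Y\<^sup>2) - r * (Y ^ 3 + [:0, 1:] ^ 3 * Y + [:0, 1:])" for Y
    by algebra
  have row3: "- ([:0, 1:] * q) + (- ([:0, 1:] * r) - [:0, 1:] ^ 3 * q) * Y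
        + (p - [:0, 1:] ^ 3 * r) * Y\<^sup>2 =
      Y\<^sup>2 * (p + q * Y + r * Y\<^sup>2) - (q + r * Y) * (Y ^ 3 + [:0, 1:] ^ 3 * Y + [:0, 1:])" for Y
    by algebra
  have col: "d y dvd p + q * [:y:] + r * [:y:]\<^sup>2"
    "d y dvd - ([:0, 1:] * r) + (p - [:0, 1:] ^ 3 * r) * [:y:] + q * [:y:]\<^sup>2"
    "d y dvd - ([:0, 1:] * q) + (- ([:0, 1:] * r) - [:0, 1:] ^ 3 * q) * [:y:]
       + (p - [:0, 1:] ^ 3 * r) * [:y:]\<^sup>2" if "y \<in> fibre x" for y
    unfolding row2 row3 using dvd1 dvd2[OF that] by (blast intro: dvd_diff dvd_mult)+
  have "d y1 * d y2 * d y3 dvd det (mult_matrix p q r ** V)"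
  proof (rule dvd_det_3)
    fix i :: 3
    have i: "i = 1 \<or> i = 2 \<or> i = 3"
      using UNIV_3 by blast
    show "d y1 dvd (mult_matrix p q r ** V) $ i $ 1"
      using i col[OF fibre(1)]
      by (auto simp only: matrix_matrix_mult_def mult_matrix_def V_def Let_def vec_lambda_beta
            sum_3 vector_3 mult_1_right)
    show "d y2 dvd (mult_matrix p q r ** V) $ i $ 2"
      using i col[OF fibre(2)]
      by (auto simp only: matrix_matrix_mult_def mult_matrix_def V_def Let_def vec_lambda_beta
            sum_3 vector_3 mult_1_right)
    show "d y3 dvd (mult_matrix p q r ** V) $ i $ 3"
      using i col[OF fibre(3)]
      by (auto simp only: matrix_matrix_mult_def mult_matrix_def V_def Let_def vec_lambda_beta
            sum_3 vector_3 mult_1_right)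
  qed
  \<comment> \<open>The Vandermonde determinant of the distinct ordinates is a nonzero constant and
    can be cancelled.\<close>
  also have "\<dots> = smult \<delta> (norm_poly p q r)"
    by (simp add: det_mul detV norm_poly_def)
  finally show ?thesis
    using dist by (simp add: dvd_smult_cancel \<delta>_def)
qed

context klein_code
begin

text \<open>Over nonzero x this is \<open>dvd_norm_poly\<close> with three distinct ordinates. The
  fibre over 0 is only the origin, and there the norm takes the value \<open>poly p 0 ^ 3\<close>,
  so a simple root suffices.\<close>

lemma card_zeros_fibre_le_order:
  assumes nz: "norm_poly p q r \<noteq> (0 :: 'a poly)"
  shows "card {y \<in> fibre x. feval p q r (x, y) = 0} \<le> order x (norm_poly p q r)"
proof (cases "x = 0")
  case True
  have "poly (norm_poly p q r) 0 = poly p 0 ^ 3"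
    by (simp add: norm_poly_eq)
  then have "order 0 (norm_poly p q r) \<noteq> 0" if "poly p 0 = 0"
    using nz that by (simp add: order_root)
  then show ?thesis
    using True
  proof (cases "poly p 0 = 0")
    case True
    have "card {y \<in> fibre x. feval p q r (x, y) = 0} \<le> card {0 :: 'a}"
      using \<open>x = 0\<close> by (intro card_mono) auto
    with True show ?thesis
      using \<open>x = 0\<close> \<open>poly p 0 = 0 \<Longrightarrow> order 0 (norm_poly p q r) \<noteq> 0\<close> by simp
  next
    case False
    then have "{y \<in> fibre x. feval p q r (x, y) = 0} = {}"
      using \<open>x = 0\<close> by (auto simp: feval_def)
    then show ?thesis
      by (simp only: card.empty le0)
  qed
next
  case False
  obtain y1 y2 y3 where fib: "fibre x = {y1, y2, y3}" and dist: "y1 \<noteq> y2" "y1 \<noteq> y3" "y2 \<noteq> y3"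
    using card_fibre[OF False] unfolding card_3_iff by auto
  define z where "z = (\<lambda>y. if feval p q r (x, y) = 0 then 1 else 0 :: nat)"
  have "card {y \<in> fibre x. feval p q r (x, y) = 0} = (\<Sum>y\<in>fibre x. z y)"
    by (simp add: z_def sum.If_cases fib Int_def)
  also have "\<dots> = z y1 + z y2 + z y3"
    using dist by (simp add: fib)
  finally have card: "card {y \<in> fibre x. feval p q r (x, y) = 0} = z y1 + z y2 + z y3" .
  have z: "(if feval p q r (x, y) = 0 then [:- x, 1:] else 1) = [:- x, 1:] ^ z y" for y
    by (simp add: z_def)
  have "[:- x, 1:] ^ z y1 * [:- x, 1:] ^ z y2 * [:- x, 1:] ^ z y3 dvd norm_poly p q r"
    using dvd_norm_poly[of y1 x y2 y3 p q r] dist by (simp add: fib z)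
  then have "[:- x, 1:] ^ (z y1 + z y2 + z y3) dvd norm_poly p q r"
    by (simp add: power_add)
  then show ?thesis
    using nz by (simp add: card order_divides)
qed

lemma card_zeros_le_degree_norm:
  assumes nz: "norm_poly p q r \<noteq> (0 :: 'a poly)"
  shows "card {j. feval p q r (P j) = 0} \<le> degree (norm_poly p q r)"
proof -
  have "card {j. feval p q r (P j) = 0} = (\<Sum>j\<in>UNIV. if feval p q r (P j) = 0 then 1 else 0)"
    by (simp add: sum.If_cases)
  also have "\<dots> = (\<Sum>z\<in>klein_points. if feval p q r z = 0 then 1 else 0)"
    by (rule sum.reindex_bij_betw[OF bij_P])
  also have "\<dots> = (\<Sum>x\<in>UNIV. \<Sum>y\<in>fibre x. if feval p q r (x, y) = 0 then 1 else 0)"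
    by (simp add: klein_points_eq_Sigma sum.Sigma)
  also have "\<dots> = (\<Sum>x\<in>UNIV. card {y \<in> fibre x. feval p q r (x, y) = 0})"
    by (simp add: sum.If_cases Int_def)
  also have "\<dots> \<le> (\<Sum>x\<in>UNIV. order x (norm_poly p q r))"
    by (intro sum_mono card_zeros_fibre_le_order nz)
  also have "\<dots> = (\<Sum>x\<in>set_mset (proots (norm_poly p q r)). order x (norm_poly p q r))"
    using nz by (intro sum.mono_neutral_right) (auto simp: order_root)
  also have "\<dots> = size (proots (norm_poly p q r))"
    using nz by (simp add: size_multiset_overloaded_eq)
  also have "\<dots> \<le> degree (norm_poly p q r)"
    by (rule size_proots_le)
  finally show ?thesis .
qed

end

text \<open>Unlike a condition on \<open>degree\<close>, this makes \<open>n = 0\<close> mean the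
  zero polynomial, so that an absent power of Y is covered uniformly.\<close>

definition degree_less :: "nat \<Rightarrow> 'a::comm_ring_1 poly set" where
  "degree_less n = {p. \<forall>k\<ge>n. coeff p k = 0}"

lemma degree_lessD: "p \<in> degree_less n \<Longrightarrow> p = 0 \<or> degree p < n"
  using leading_coeff_neq_0 by (fastforce simp: degree_less_def not_le[symmetric])

text \<open>One condition for each of the eight terms of \<open>norm_poly_eq\<close>; a condition is
  vacuous when a factor of its term is forced to be 0. Mixed terms can dominate: for X^2 + X Y, the
  term X^3 p q^2 has degree 7, while p^3 and X q^3 have degrees 6 and 4.\<close>

definition norm_bound :: "nat \<Rightarrow> nat \<Rightarrow> nat \<Rightarrow> nat \<Rightarrow> bool" where
  "norm_bound a b c D \<longleftrightarrow>
     (\<forall>i<a. 3 * i \<le> D) \<and> (\<forall>j<b. 3 * j + 1 \<le> D) \<and> (\<forall>k<c. 3 * k + 2 \<le> D) \<and>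
     (\<forall>i<a. \<forall>k<c. 2 * i + k + 3 \<le> D) \<and> (\<forall>i<a. \<forall>k<c. i + 2 * k + 6 \<le> D) \<and>
     (\<forall>i<a. \<forall>j<b. i + 2 * j + 3 \<le> D) \<and> (\<forall>j<b. \<forall>k<c. j + 2 * k + 4 \<le> D) \<and>
     (\<forall>i<a. \<forall>j<b. \<forall>k<c. i + j + k + 1 \<le> D)"

lemma degree_norm_poly_le:
  fixes p q r :: "'a::idom poly"
  assumes pqr: "p \<in> degree_less a" "q \<in> degree_less b" "r \<in> degree_less c"
    and bound: "norm_bound a b c D"
  shows "degree (norm_poly p q r) \<le> D"
proof -
  note pqr = pqr[THEN degree_lessD]
  define X where "X = [:0, 1 :: 'a:]"
  have deg_X: "degree X \<le> 1"
    by (simp add: X_def)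
  have const: "degree (1 :: 'a poly) = 0" "degree (2 :: 'a poly) = 0" "degree (3 :: 'a poly) = 0"
    by (simp, (metis degree_numeral)+)
  have deg: "degree (n * X ^ h * p ^ i * q ^ j * r ^ k) \<le> D"
    if "degree n = 0" "h + i * degree p + j * degree q + k * degree r \<le> D" for n :: "'a poly" and h i j k
  proof -
    have "degree (n * X ^ h * p ^ i * q ^ j * r ^ k)
        \<le> degree n + degree (X ^ h) + degree (p ^ i) + degree (q ^ j) + degree (r ^ k)"
      by (meson add_le_mono1 degree_mult_le order_trans)
    also have "\<dots> \<le> 0 + degree X * h + degree p * i + degree q * j + degree r * k"
      using that(1) by (intro add_mono degree_power_le) auto
    also have "\<dots> \<le> h + i * degree p + j * degree q + k * degree r"
      using mult_right_mono[OF deg_X, of h] by (simp add: mult.commute)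
    finally show ?thesis
      using that(2) by linarith
  qed
  have "degree (p ^ 3) \<le> D"
  proof (cases "p = 0")
    case False
    then have "3 * degree p \<le> D"
      using bound pqr unfolding norm_bound_def by blast
    then show ?thesis
      using deg[of 1 0 3 0 0] const by (simp add: algebra_simps)
  qed auto
  moreover have "degree (2 * X ^ 3 * p\<^sup>2 * r) \<le> D"
  proof (cases "p = 0 \<or> r = 0")
    case False
    then have "2 * degree p + degree r + 3 \<le> D"
      using bound pqr unfolding norm_bound_def by blast
    then show ?thesis
      using deg[of 2 3 2 0 1] const by (simp add: algebra_simps)
  qed auto
  moreover have "degree (X ^ 6 * p * r\<^sup>2) \<le> D"
  proof (cases "p = 0 \<or> r = 0")
    case False
    then have "degree p + 2 * degree r + 6 \<le> D"
      using bound pqr unfolding norm_bound_def by blast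
    then show ?thesis
      using deg[of 1 6 1 0 2] const by (simp add: algebra_simps)
  qed auto
  moreover have "degree (3 * X * p * q * r) \<le> D"
  proof (cases "p = 0 \<or> q = 0 \<or> r = 0")
    case False
    then have "degree p + degree q + degree r + 1 \<le> D"
      using bound pqr unfolding norm_bound_def by blast
    then show ?thesis
      using deg[of 3 1 1 1 1] const by (simp add: algebra_simps)
  qed auto
  moreover have "degree (X ^ 3 * p * q\<^sup>2) \<le> D"
  proof (cases "p = 0 \<or> q = 0")
    case False
    then have "degree p + 2 * degree q + 3 \<le> D"
      using bound pqr unfolding norm_bound_def by blast
    then show ?thesis
      using deg[of 1 3 1 2 0] const by (simp add: algebra_simps)
  qed auto
  moreover have "degree (X * q ^ 3) \<le> D"
  proof (cases "q = 0")
    case False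
    then have "3 * degree q + 1 \<le> D"
      using bound pqr unfolding norm_bound_def by blast
    then show ?thesis
      using deg[of 1 1 0 3 0] const by (simp add: algebra_simps)
  qed auto
  moreover have "degree (X\<^sup>2 * r ^ 3) \<le> D"
  proof (cases "r = 0")
    case False
    then have "3 * degree r + 2 \<le> D"
      using bound pqr unfolding norm_bound_def by blast
    then show ?thesis
      using deg[of 1 2 0 0 3] const by (simp add: algebra_simps)
  qed auto
  moreover have "degree (X ^ 4 * q * r\<^sup>2) \<le> D"
  proof (cases "q = 0 \<or> r = 0")
    case False
    then have "degree q + 2 * degree r + 4 \<le> D"
      using bound pqr unfolding norm_bound_def by blast
    then show ?thesis
      using deg[of 1 4 0 1 2] const by (simp add: algebra_simps)
  qed auto
  ultimately show ?thesis
    unfolding norm_poly_eq X_def[symmetric] by (intro degree_add_le degree_diff_le)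
qed

section \<open>Evaluation codes with bounded degrees in X\<close>

context klein_code
begin

definition poly_code :: "nat \<Rightarrow> nat \<Rightarrow> nat \<Rightarrow> ('a ^ 22) set" where
  "poly_code a b c = {v. \<exists>p\<in>degree_less a. \<exists>q\<in>degree_less b. \<exists>r\<in>degree_less c.
     \<forall>j. v $ j = feval p q r (P j)}"

lemma poly_codeI:
  assumes "p \<in> degree_less a" "q \<in> degree_less b" "r \<in> degree_less c"
    and "\<And>j. v $ j = feval p q r (P j)"
  shows "v \<in> poly_code a b c"
  using assms unfolding poly_code_def by blast

lemma subspace_poly_code: "vec.subspace (poly_code a b c)"
proof (rule vec.subspaceI)
  show "0 \<in> poly_code a b c"
    by (intro poly_codeI[of 0 _ 0 _ 0]) (auto simp: feval_def degree_less_def)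
next
  fix v w assume "v \<in> poly_code a b c" "w \<in> poly_code a b c"
  then obtain p q r p' q' r' where
    "p \<in> degree_less a" "q \<in> degree_less b" "r \<in> degree_less c" "\<And>j. v $ j = feval p q r (P j)"
    "p' \<in> degree_less a" "q' \<in> degree_less b" "r' \<in> degree_less c" "\<And>j. w $ j = feval p' q' r' (P j)"
    unfolding poly_code_def by blast
  then show "v + w \<in> poly_code a b c"
    by (intro poly_codeI[of "p + p'" _ "q + q'" _ "r + r'"])
       (auto simp: feval_def degree_less_def algebra_simps)
next
  fix v :: "'a ^ 22" and k assume "v \<in> poly_code a b c"
  then obtain p q r where
    "p \<in> degree_less a" "q \<in> degree_less b" "r \<in> degree_less c" "\<And>j. v $ j = feval p q r (P j)"
    unfolding poly_code_def by blast
  then show "k *s v \<in> poly_code a b c"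
    by (intro poly_codeI[of "smult k p" _ "smult k q" _ "smult k r"])
       (auto simp: feval_def degree_less_def algebra_simps)
qed

lemma poly_code_weight:
  assumes v: "v \<in> poly_code a b c" "v \<noteq> 0" and bound: "norm_bound a b c D"
  shows "22 - D \<le> hamming_weight v"
proof -
  obtain p q r where
    pqr: "p \<in> degree_less a" "q \<in> degree_less b" "r \<in> degree_less c" and
    eval: "\<And>j. v $ j = feval p q r (P j)"
    using v(1) unfolding poly_code_def by blast
  have "\<not> (p = 0 \<and> q = 0 \<and> r = 0)"
    using v(2) by (auto simp: vec_eq_iff eval feval_def)
  then have "norm_poly p q r \<noteq> 0"
    using norm_poly_eq_0 by blast
  then have "card {j. feval p q r (P j) = 0} \<le> D"
    using card_zeros_le_degree_norm degree_norm_poly_le[OF pqr bound] order_trans by blast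
  moreover have "{j. v $ j \<noteq> 0} = UNIV - {j. feval p q r (P j) = 0}"
    by (auto simp: eval)
  then have "hamming_weight v = 22 - card {j. feval p q r (P j) = 0}"
    by (simp add: hamming_weight_def card_Diff_subset)
  ultimately show ?thesis
    by simp
qed

lemma monomial_in_poly_code:
  assumes "y = 0 \<and> x < a \<or> y = 1 \<and> x < b \<or> y = 2 \<and> x < c"
  shows "ev P (monomXY x y) \<in> poly_code a b c"
proof -
  have 0: "0 \<in> degree_less n" and monom: "x < n \<Longrightarrow> monom 1 x \<in> degree_less n" for n
    by (auto simp: degree_less_def)
  have eval: "feval (monom 1 x) 0 0 z = fst z ^ x" "feval 0 (monom 1 x) 0 z = fst z ^ x * snd z"
    "feval 0 0 (monom 1 x) z = fst z ^ x * (snd z)\<^sup>2" for z :: "'a \<times> 'a"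
    by (simp_all add: feval_def poly_monom)
  from assms consider "y = 0" "x < a" | "y = 1" "x < b" | "y = 2" "x < c"
    by blast
  then show ?thesis
  proof cases
    case 1
    with 0 monom show ?thesis
      by (intro poly_codeI[of "monom 1 x" _ 0 _ 0]) (simp_all add: ev_def eval)
  next
    case 2
    with 0 monom show ?thesis
      by (intro poly_codeI[of 0 _ "monom 1 x" _ 0]) (simp_all add: ev_def eval)
  next
    case 3
    with 0 monom show ?thesis
      by (intro poly_codeI[of 0 _ 0 _ "monom 1 x"]) (simp_all add: ev_def eval)
  qed
qed

end

subsection \<open>The monomial basis and its dual\<close>

text \<open>The products of dual monomials are \<open>X\<^sup>7\<close> or \<open>X\<^sup>6 Y\<^sup>3\<close>, the exponents of this shape
  being those for which the sum over all points does not vanish.\<close>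

definition dual_index :: "nat \<Rightarrow> nat" where
  "dual_index i = [18,15,22,12,21,9,20,19,6,17,16,4,14,13,2,11,10,1,8,7,5,3] ! (i - 1)"

text \<open>Among the listed exponents the only coincidence beyond the pairing
  \<open>dual_index\<close> is X^7 with itself, since 7 also divides 14.\<close>

lemma gram_check:
  "\<forall>i\<in>{1..22}. \<forall>j\<in>{1..22}.
     case (M_exponents ! (i - 1), M_exponents ! (j - 1)) of ((a, b), (a', b')) \<Rightarrow>
       b + b' \<le> 4 \<and>
       (b + b' = 0 \<and> a + a' > 0 \<and> 7 dvd a + a' \<or> b + b' = 3 \<and> 7 dvd Suc (a + a') \<longleftrightarrow>
        j = dual_index i \<or> i = 18 \<and> j = 18)"
  by code_simp

lemma dual_index_check:
  "\<forall>i\<in>{1..22}. dual_index i \<in> {1..22} \<and> dual_index (dual_index i) = i"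
  by code_simp

lemma dual_index_in: "i \<in> {1..22} \<Longrightarrow> dual_index i \<in> {1..22}"
  and dual_index_dual_index: "i \<in> {1..22} \<Longrightarrow> dual_index (dual_index i) = i"
  using dual_index_check by blast+

lemma dual_index_1_18 [simp]: "dual_index 1 = 18" "dual_index (Suc 0) = 18" "dual_index 18 = 1"
  by code_simp+

definition fits :: "nat \<Rightarrow> nat \<Rightarrow> nat \<Rightarrow> nat \<Rightarrow> bool" where
  "fits a b c i = (case M_exponents ! (i - 1) of
     (x, y) \<Rightarrow> y = 0 \<and> x < a \<or> y = 1 \<and> x < b \<or> y = 2 \<and> x < c)"

context klein_code
begin

definition mvec :: "nat \<Rightarrow> 'a ^ 22" where
  "mvec i = ev P (M i)"

text \<open>The correction for \<open>j = 1\<close> is due to \<open>X\<^sup>7\<close> not being orthogonal to itself.\<close>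

definition dvec :: "nat \<Rightarrow> 'a ^ 22" where
  "dvec j = (if j = 1 then mvec 18 - mvec 1 else mvec (dual_index j))"

lemma bform_mvec_mvec:
  assumes "i \<in> {1..22}" "j \<in> {1..22}"
  shows "bform (mvec i) (mvec j) = (if j = dual_index i \<or> i = 18 \<and> j = 18 then 1 else 0)"
proof -
  obtain x y x' y' where e: "M_exponents ! (i - 1) = (x, y)" "M_exponents ! (j - 1) = (x', y')"
    by fastforce
  have "bform (mvec i) (mvec j) = (\<Sum>k\<in>UNIV. fst (P k) ^ (x + x') * snd (P k) ^ (y + y'))"
    using e by (simp add: bform_def mvec_def M_def ev_def power_add mult_ac)
  then show ?thesis
    using gram_check[THEN bspec, OF assms(1), THEN bspec, OF assms(2)] e
    by (simp add: sum_points_monomial)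
qed

sublocale biorthogonal mvec dvec "{1..22}"
proof
  fix i j :: nat assume i: "i \<in> {1..22}" and j: "j \<in> {1..22}"
  show "bform (mvec i) (dvec j) = (if i = j then 1 else 0)"
  proof (cases "j = 1")
    case True
    \<comment> \<open>For \<open>i = 18\<close> the pairings with \<open>mvec 18\<close> and
      \<open>mvec 1\<close> are both 1 and cancel in \<open>dvec 1\<close>.\<close>
    moreover have "18 = dual_index i \<longleftrightarrow> i = 1" "1 = dual_index i \<longleftrightarrow> i = 18"
      using dual_index_dual_index[OF i] dual_index_1_18 by metis+
    ultimately show ?thesis
      using i by (auto simp: dvec_def bform_mvec_mvec)
  next
    case False
    have "dual_index j = dual_index i \<longleftrightarrow> i = j"
      using dual_index_dual_index i j by metis
    moreover have "dual_index j \<noteq> 18"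
      using False dual_index_dual_index[OF j] by auto
    ultimately show ?thesis
      using False i j dual_index_in[OF j] by (simp add: dvec_def bform_mvec_mvec)
  qed
qed simp_all

lemma mvec_eq: "M_exponents ! (i - 1) = (x, y) \<Longrightarrow> mvec i = ev P (monomXY x y)"
  by (simp add: mvec_def M_def)

lemma mvec_in_poly_code: "fits a' b' c' i \<Longrightarrow> mvec i \<in> poly_code a' b' c'"
  by (cases "M_exponents ! (i - 1)")
     (auto simp: fits_def mvec_eq intro: monomial_in_poly_code)

lemma weight_span_mvec:
  assumes "\<forall>i\<in>I. fits a' b' c' i" and "norm_bound a' b' c' D"
    and "v \<in> vec.span (mvec ` I)" "v \<noteq> 0"
  shows "22 - D \<le> hamming_weight v"
proof -
  have "vec.span (mvec ` I) \<subseteq> poly_code a' b' c'"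
    using assms(1) by (intro vec.span_minimal subspace_poly_code) (auto intro: mvec_in_poly_code)
  then show ?thesis
    using assms poly_code_weight by blast
qed

text \<open>With 1 in \<open>I\<close> the exceptional vector \<open>dvec 1\<close> drops out, so
  the dual code is spanned by plain monomials and the norm bound applies to it.\<close>

lemma weight_dual_code_span_mvec:
  assumes "I \<subseteq> {1..22}" "1 \<in> I" and "\<forall>i\<in>{1..22} - I. fits a' b' c' (dual_index i)"
    and "norm_bound a' b' c' D" and "v \<in> dual_code (vec.span (mvec ` I))" "v \<noteq> 0"
  shows "22 - D \<le> hamming_weight v"
proof -
  have "dvec ` ({1..22} - I) = mvec ` (dual_index ` ({1..22} - I))"
    using assms(2) by (auto simp: dvec_def image_image intro!: image_cong)
  then show ?thesis
    using assms by (intro weight_span_mvec[of "dual_index ` ({1..22} - I)"])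
      (simp_all add: dual_code_span_m)
qed

lemma moments:
  "moment v 0 0 = bform v (mvec 1)" "moment v 1 0 = bform v (mvec 2)" "moment v 0 1 = bform v (mvec 3)"
  "moment v 2 0 = bform v (mvec 4)" "moment v 1 1 = bform v (mvec 5)" "moment v 3 0 = bform v (mvec 6)"
  "moment v 0 2 = bform v (mvec 7)" "moment v 2 1 = bform v (mvec 8)"
  by (simp_all add: moment_eq_bform mvec_def M_def M_exponents_def numeral_eq_Suc)

lemma bform_dual_code:
  "v \<in> dual_code (vec.span (mvec ` I)) \<Longrightarrow> k \<in> I \<Longrightarrow> bform v (mvec k) = 0"
  by (auto simp: in_dual_code_span_iff)

text \<open>A span that misses the partner of \<open>M k\<close> is orthogonal to
  \<open>M k\<close>; the range of \<open>k\<close> avoids the self-pairing of X^7. This makes the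
  moment bounds available for the large codes given as spans.\<close>

lemma bform_span_mvec:
  assumes v: "v \<in> vec.span (mvec ` I)" and I: "I \<subseteq> {1..22}" and k: "k \<in> {1..17}" "dual_index k \<notin> I"
  shows "bform v (mvec k) = 0"
proof -
  have "k \<in> {1..22}" "k \<noteq> 18"
    using k by auto
  then have "\<forall>c\<in>mvec ` I. bform (mvec k) c = 0"
    using I k by (auto simp: bform_mvec_mvec subset_iff)
  then have "mvec k \<in> dual_code (vec.span (mvec ` I))"
    by (simp add: in_dual_code_span_iff)
  with v show ?thesis
    by (simp add: in_dual_code_iff bform_commute)
qed

end

subsection \<open>The parameters\<close>

lemma index_sets:
  "{i \<in> {1..22}. mu i < 4} = {1, 2, 3, 4, 7}"
  "{i \<in> {1..22}. sigma i \<ge> 5} = insert 16 {1..14}"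
  "{i \<in> {1..22}. sigma i \<ge> 3} = insert 19 {1..17}"
  "{i \<in> {1..22}. sigma i \<ge> 2} = {1..22} - {18, 22}"
proof -
  have "\<forall>i\<in>{1..22}. mu i < 4 \<longleftrightarrow> i \<in> {1, 2, 3, 4, 7}"
    "\<forall>i\<in>{1..22}. sigma i \<ge> 5 \<longleftrightarrow> i \<in> insert 16 {1..14}"
    "\<forall>i\<in>{1..22}. sigma i \<ge> 3 \<longleftrightarrow> i \<in> insert 19 {1..17}"
    "\<forall>i\<in>{1..22}. sigma i \<ge> 2 \<longleftrightarrow> i \<notin> {18, 22}"
    by code_simp+
  then show
    "{i \<in> {1..22}. mu i < 4} = {1, 2, 3, 4, 7}"
    "{i \<in> {1..22}. sigma i \<ge> 5} = insert 16 {1..14}"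
    "{i \<in> {1..22}. sigma i \<ge> 3} = insert 19 {1..17}"
    "{i \<in> {1..22}. sigma i \<ge> 2} = {1..22} - {18, 22}"
    by auto
qed

context klein_code
begin

lemma E_eq: "E P s = vec.span (mvec ` {1..s})"
  unfolding E_def mvec_def setcompr_eq_image Collect_mem_eq ..

lemma E_tilde_eq: "E_tilde P \<delta> = vec.span (mvec ` {i \<in> {1..22}. sigma i \<ge> \<delta>})"
  unfolding E_tilde_def mvec_def by (simp add: setcompr_eq_image)

lemma C_tilde_eq: "C_tilde P \<delta> = dual_code (vec.span (mvec ` {i \<in> {1..22}. mu i < \<delta>}))"
  unfolding C_tilde_def mvec_def by (simp add: setcompr_eq_image)

text \<open>A word outside the smaller code is nonzero, so minimum weights bound the relative
  distances from below.\<close>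

lemma css_bounds_index_sets:
  assumes "I2 \<subset> I1" "I1 \<subseteq> {1..22}" "card I1 = card I2 + l"
    and "\<And>v. v \<noteq> 0 \<Longrightarrow> v \<in> vec.span (mvec ` I1) \<Longrightarrow> dZ \<le> hamming_weight v"
    and "\<And>v. v \<noteq> 0 \<Longrightarrow> v \<in> dual_code (vec.span (mvec ` I2)) \<Longrightarrow> dX \<le> hamming_weight v"
  shows "css_bounds l dZ dX (vec.span (mvec ` I1)) (vec.span (mvec ` I2))"
proof (rule css_bounds_span_m)
  show "dZ \<le> hamming_weight v" if "v \<in> vec.span (mvec ` I1)" "v \<notin> vec.span (mvec ` I2)" for v
    using assms(4)[OF _ that(1)] that(2) vec.span_zero by metis
  show "dX \<le> hamming_weight v"
    if "v \<in> dual_code (vec.span (mvec ` I2))" "v \<notin> dual_code (vec.span (mvec ` I1))" for v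
  proof -
    have "v \<noteq> 0"
      using that(2) by (auto simp: in_dual_code_iff bform_commute[of 0])
    then show ?thesis
      using that(1) by (rule assms(5))
  qed
qed (use assms in auto)

lemma css_bounds_dual_index_sets:
  assumes "I1 \<subset> I2" "I2 \<subseteq> {1..22}" "card I2 = card I1 + l"
    and "\<And>v. v \<noteq> 0 \<Longrightarrow> v \<in> dual_code (vec.span (mvec ` I1)) \<Longrightarrow> dZ \<le> hamming_weight v"
    and "\<And>v. v \<noteq> 0 \<Longrightarrow> v \<in> vec.span (mvec ` I2) \<Longrightarrow> dX \<le> hamming_weight v"
  shows "css_bounds l dZ dX (dual_code (vec.span (mvec ` I1))) (dual_code (vec.span (mvec ` I2)))"
proof -
  have sub: "I1 \<subseteq> {1..22}"
    using assms(1,2) by blast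
  have dual: "dual_code (vec.span (mvec ` I1)) = vec.span (dvec ` ({1..22} - I1))"
    "dual_code (vec.span (mvec ` I2)) = vec.span (dvec ` ({1..22} - I2))"
    using sub assms(2) by (simp_all add: dual_code_span_m)
  have fin: "finite I1" "finite I2"
    using sub assms(2) by (auto intro: finite_subset)
  have "card I2 \<le> 22"
    using card_mono[OF _ assms(2)] by simp
  show ?thesis
    unfolding dual
  proof (rule biorthogonal.css_bounds_span_m[OF flip])
    show "{1..22} - I2 \<subset> {1..22} - I1"
      using assms(1,2) by blast
    show "card ({1..22} - I1) = card ({1..22} - I2) + l"
      using fin sub assms(2,3) \<open>card I2 \<le> 22\<close> by (simp add: card_Diff_subset)
    show "dZ \<le> hamming_weight v"
      if "v \<in> vec.span (dvec ` ({1..22} - I1))" "v \<notin> vec.span (dvec ` ({1..22} - I2))" for v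
      using assms(4) that vec.span_zero unfolding dual by metis
    show "dX \<le> hamming_weight v"
      if "v \<in> dual_code (vec.span (dvec ` ({1..22} - I2)))"
        "v \<notin> dual_code (vec.span (dvec ` ({1..22} - I1)))" for v
      \<comment> \<open>Taking the dual twice brings back the spans of monomials.\<close>
      using assms(5) that vec.span_zero dual_code_dual_code_span_m[OF sub]
        dual_code_dual_code_span_m[OF assms(2)] unfolding dual by metis
  qed auto
qed

section \<open>Weights of the individual codes\<close>

lemma fits_checks:
  "\<forall>i\<in>{1..1}. fits 1 0 0 i" "\<forall>i\<in>{1..2}. fits 2 0 0 i" "\<forall>i\<in>{1..5}. fits 3 2 0 i"
  "\<forall>i\<in>{1..7}. fits 4 2 1 i" "\<forall>i\<in>{1..8}. fits 4 3 1 i" "\<forall>i\<in>{1..10}. fits 5 3 2 i"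
  "\<forall>i\<in>{1..11}. fits 5 4 2 i" "\<forall>i\<in>{1..13}. fits 6 4 3 i" "\<forall>i\<in>{1..14}. fits 6 5 3 i"
  "\<forall>i\<in>insert 16 {1..14}. fits 6 5 4 i"
  "\<forall>i\<in>{1..22} - {1..10}. fits 3 5 4 (dual_index i)"
  "\<forall>i\<in>{1..22} - {1..13}. fits 2 4 3 (dual_index i)"
  by code_simp+

text \<open>The triples are those of \<open>fits_checks\<close>, each entry one above the largest
  X-exponent occurring with Y^0, Y^1 or Y^2. The last number is the largest degree of a norm term,
  and 22 minus it is the resulting weight.\<close>

lemma norm_bounds:
  "norm_bound 1 0 0 0" "norm_bound 2 0 0 3" "norm_bound 3 2 0 7" "norm_bound 4 2 1 9"
  "norm_bound 4 3 1 10" "norm_bound 5 3 2 12" "norm_bound 5 4 2 13" "norm_bound 6 4 3 15"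
  "norm_bound 6 5 3 16" "norm_bound 6 5 4 17" "norm_bound 3 5 4 14" "norm_bound 2 4 3 11"
  by (simp_all add: norm_bound_def)

lemma weight_span_norm:
  assumes "v \<noteq> 0"
  shows
    "v \<in> vec.span (mvec ` {1..1}) \<Longrightarrow> 22 \<le> hamming_weight v"
    "v \<in> vec.span (mvec ` {1..2}) \<Longrightarrow> 19 \<le> hamming_weight v"
    "v \<in> vec.span (mvec ` {1..5}) \<Longrightarrow> 15 \<le> hamming_weight v"
    "v \<in> vec.span (mvec ` {1..7}) \<Longrightarrow> 13 \<le> hamming_weight v"
    "v \<in> vec.span (mvec ` {1..8}) \<Longrightarrow> 12 \<le> hamming_weight v"
    "v \<in> vec.span (mvec ` {1..10}) \<Longrightarrow> 10 \<le> hamming_weight v"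
    "v \<in> vec.span (mvec ` {1..11}) \<Longrightarrow> 9 \<le> hamming_weight v"
    "v \<in> vec.span (mvec ` {1..13}) \<Longrightarrow> 7 \<le> hamming_weight v"
    "v \<in> vec.span (mvec ` {1..14}) \<Longrightarrow> 6 \<le> hamming_weight v"
    "v \<in> vec.span (mvec ` (insert 16 {1..14})) \<Longrightarrow> 5 \<le> hamming_weight v"
  subgoal using weight_span_mvec[OF fits_checks(1) norm_bounds(1) _ assms] by simp
  subgoal using weight_span_mvec[OF fits_checks(2) norm_bounds(2) _ assms] by simp
  subgoal using weight_span_mvec[OF fits_checks(3) norm_bounds(3) _ assms] by simp
  subgoal using weight_span_mvec[OF fits_checks(4) norm_bounds(4) _ assms] by simp
  subgoal using weight_span_mvec[OF fits_checks(5) norm_bounds(5) _ assms] by simp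
  subgoal using weight_span_mvec[OF fits_checks(6) norm_bounds(6) _ assms] by simp
  subgoal using weight_span_mvec[OF fits_checks(7) norm_bounds(7) _ assms] by simp
  subgoal using weight_span_mvec[OF fits_checks(8) norm_bounds(8) _ assms] by simp
  subgoal using weight_span_mvec[OF fits_checks(9) norm_bounds(9) _ assms] by simp
  subgoal using weight_span_mvec[OF fits_checks(10) norm_bounds(10) _ assms] by simp
  done

lemma weight_dual_norm:
  assumes "v \<noteq> 0"
  shows
    "v \<in> dual_code (vec.span (mvec ` {1..10})) \<Longrightarrow> 8 \<le> hamming_weight v"
    "v \<in> dual_code (vec.span (mvec ` {1..13})) \<Longrightarrow> 11 \<le> hamming_weight v"
  subgoal using weight_dual_code_span_mvec[OF _ _ fits_checks(11) norm_bounds(11) _ assms] by simp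
  subgoal using weight_dual_code_span_mvec[OF _ _ fits_checks(12) norm_bounds(12) _ assms] by simp
  done

text \<open>E(17) lacks the partners 18, 22, 21, 20, 19 of 1, Y, XY, Y^2, X^2 Y and is thus
  orthogonal to these five. Adding index 19 gives up X^2 Y; the last code still lacks 18, the
  partner of 1.\<close>

lemma weight_span_moments:
  assumes "v \<noteq> 0"
  shows
    "v \<in> vec.span (mvec ` {1..17}) \<Longrightarrow> 4 \<le> hamming_weight v"
    "v \<in> vec.span (mvec ` insert 19 {1..17}) \<Longrightarrow> 3 \<le> hamming_weight v"
    "v \<in> vec.span (mvec ` ({1..22} - {18, 22})) \<Longrightarrow> 2 \<le> hamming_weight v"
proof -
  have dual_index: "dual_index 1 = 18" "dual_index 3 = 22" "dual_index 5 = 21"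
    "dual_index 7 = 20" "dual_index 8 = 19"
    by code_simp+
  show "4 \<le> hamming_weight v" if "v \<in> vec.span (mvec ` {1..17})"
    by (rule weight_ge_4_horizontal[unfolded moments])
      (auto intro!: bform_span_mvec[OF that] simp: dual_index assms)
  show "3 \<le> hamming_weight v" if "v \<in> vec.span (mvec ` insert 19 {1..17})"
    by (rule weight_ge_3_horizontal[unfolded moments])
      (auto intro!: bform_span_mvec[OF that] simp: dual_index assms)
  show "2 \<le> hamming_weight v" if "v \<in> vec.span (mvec ` ({1..22} - {18, 22}))"
    by (rule weight_ge_2[unfolded moments])
      (auto intro!: bform_span_mvec[OF that] simp: dual_index assms)
qed

lemma weight_dual_moments:
  assumes "v \<noteq> 0"
  shows
    "v \<in> dual_code (vec.span (mvec ` {1..1})) \<Longrightarrow> 2 \<le> hamming_weight v"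
    "v \<in> dual_code (vec.span (mvec ` {1..3})) \<Longrightarrow> 3 \<le> hamming_weight v"
    "v \<in> dual_code (vec.span (mvec ` {1, 2, 3, 4, 7})) \<Longrightarrow> 4 \<le> hamming_weight v"
    "v \<in> dual_code (vec.span (mvec ` {1..7})) \<Longrightarrow> 6 \<le> hamming_weight v"
proof -
  show "2 \<le> hamming_weight v" if "v \<in> dual_code (vec.span (mvec ` {1..1}))"
    by (rule weight_ge_2[unfolded moments]) (auto intro!: bform_dual_code[OF that] simp: assms)
  show "3 \<le> hamming_weight v" if "v \<in> dual_code (vec.span (mvec ` {1..3}))"
    by (rule weight_ge_3_line[unfolded moments]) (auto intro!: bform_dual_code[OF that] simp: assms)
  show "4 \<le> hamming_weight v" if "v \<in> dual_code (vec.span (mvec ` {1, 2, 3, 4, 7}))"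
    by (rule weight_ge_4_vertical[unfolded moments]) (auto intro!: bform_dual_code[OF that] simp: assms)
  show "6 \<le> hamming_weight v" if "v \<in> dual_code (vec.span (mvec ` {1..7}))"
    by (rule weight_ge_6[unfolded moments]) (auto intro!: bform_dual_code[OF that] simp: assms)
qed

text \<open>The codes differ only by the condition for \<open>M 5\<close>, that is XY, so a word in
  the difference has a nonzero moment there.\<close>

lemma weight_dual_relative:
  assumes v: "v \<in> dual_code (vec.span (mvec ` {1..4}))" "v \<notin> dual_code (vec.span (mvec ` {1..5}))"
  shows "4 \<le> hamming_weight v"
proof -
  have "{1..5} = insert 5 {1..4 :: nat}"
    by auto
  then have "bform v (mvec 5) \<noteq> 0"
    using v by (auto simp: in_dual_code_span_iff)
  then show ?thesis
    by (intro weight_ge_4_relative[unfolded moments]) (auto intro: bform_dual_code[OF v(1)])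
qed

lemmas weights = weight_span_norm weight_span_moments weight_dual_norm weight_dual_moments

end

theorem mainTheorem9:
  fixes P :: "22 \<Rightarrow> 'a::{field,finite} \<times> 'a"
  assumes "CARD('a) = 8"
    and "bij_betw P UNIV klein_points"
  shows "css_bounds 1 22 1 (E P 1) {0} \<and>
         css_bounds 1 19 2 (E P 2) (E P 1) \<and>
         css_bounds 1 15 4 (E P 5) (E P 4) \<and>
         css_bounds 1 9 8 (E P 11) (E P 10) \<and>
         css_bounds 2 15 3 (E P 5) (E P 3) \<and>
         css_bounds 2 11 5 (C P 13) (dual_code (E_tilde P 5)) \<and>
         css_bounds 3 12 4 (E P 8) (dual_code (C_tilde P 4)) \<and>
         css_bounds 3 10 6 (E P 10) (E P 7) \<and>
         css_bounds 3 8 7 (C P 10) (C P 13) \<and>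
         css_bounds 4 13 3 (E P 7) (E P 3) \<and>
         css_bounds 5 10 4 (E P 10) (dual_code (C_tilde P 4)) \<and>
         css_bounds 7 6 6 (E P 14) (E P 7) \<and>
         css_bounds 11 6 3 (E P 14) (E P 3) \<and>
         css_bounds 12 4 4 (E P 17) (dual_code (C_tilde P 4)) \<and>
         css_bounds 14 4 3 (E P 17) (E P 3) \<and>
         css_bounds 15 3 3 (E_tilde P 3) (E P 3) \<and>
         css_bounds 19 2 2 (E_tilde P 2) (E P 1)"
proof -
  interpret klein_code P
    using assms by unfold_locales
  have dual_C_tilde: "dual_code (C_tilde P 4) = vec.span (mvec ` {1, 2, 3, 4, 7})"
    unfolding C_tilde_eq index_sets by (rule dual_code_dual_code_span_m) auto
  \<comment> \<open>Written as an empty span, the zero code falls under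
    \<open>css_bounds_index_sets\<close>.\<close>
  have zero: "{0} = vec.span (mvec ` {})"
    by simp
  show ?thesis
    unfolding dual_C_tilde C_def E_tilde_eq index_sets E_eq zero
  proof (intro conjI)
    show "css_bounds 1 22 1 (vec.span (mvec ` {1..1})) (vec.span (mvec ` {}))"
    proof (rule css_bounds_index_sets)
      show "1 \<le> hamming_weight v" if "v \<noteq> 0" for v :: "'a ^ 22"
        using that by (simp add: Suc_le_eq hamming_weight_eq card_gt_0_iff supp_eq_empty_iff)
    qed (force, force, simp, erule (1) weights)
    show "css_bounds 1 15 4 (vec.span (mvec ` {1..5})) (vec.span (mvec ` {1..4}))"
    proof (rule css_bounds_span_m)
      show "15 \<le> hamming_weight v"
        if "v \<in> vec.span (mvec ` {1..5})" "v \<notin> vec.span (mvec ` {1..4})" for v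
        using weights(3)[OF _ that(1)] that(2) vec.span_zero by metis
      show "4 \<le> hamming_weight v"
        if "v \<in> dual_code (vec.span (mvec ` {1..4}))" "v \<notin> dual_code (vec.span (mvec ` {1..5}))" for v
        using that by (rule weight_dual_relative)
    qed auto
  \<comment> \<open>In the remaining tuples unification reads off the index sets, and
    \<open>weights\<close> supplies a minimum weight for each of the two codes.\<close>
  qed (rule css_bounds_index_sets css_bounds_dual_index_sets, force, force, simp,
       (erule (1) weights)+)+
qed

end
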